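(* Fix $\beta_0>0$ and let $G_N$ be a sequence of $d_N$-regular graphs on $N$ vertices, $d_N\ge1$. Let $\{\hat\beta_N\}_{N\ge1}$ be the maximum pseudolikelihood estimators for the Ising model with sufficient statistic $H_N(\tau)=\frac1{d_N}\tau'A(G_N)\tau$, where $A(G_N)$ is the adjacency matrix of $G_N$. (a) If $0<\beta_0<1$, then $\{\hat\beta_N\}_{N\ge1}$ is $\sqrt{N/d_N}$-consistent at $\beta_0$. (b) If $\beta_0>1$, then $\{\hat\beta_N\}_{N\ge1}$ is $\sqrt N$-consistent at $\beta_0$.
   Context: Here graphs are simple. Put $J_N=\frac1{d_N}A(G_N)$, $S_N=\{-1,1\}^N$, $H_N(\tau)=\tau'J_N\tau$. For $\beta\ge0$, $$\mathbb{P}_\beta(\sigma=\tau)=2^{-N}\exp\{\tfrac12\beta H_N(\tau)-F_N(\beta)\},\qquad F_N(\beta)=\log\Big\{2^{-N}\sum_{\tau\in S_N}e^{\frac12\beta H_N(\tau)}\Big\}.$$ With $m_i(\tau)=\sum_jJ_N(i,j)\tau_j$ and $L_\tau(x)=\frac1N\sum_{i=1}^Nm_i(\tau)(\tau_i-\tanh(x\,m_i(\tau)))$ (nonincreasing in $x\ge0$; it is $\frac1N$ times the derivative of the log-pseudolikelihood $\sum_i\log\mathbb{P}_x(\sigma_i=\tau_i\mid(\sigma_j)_{j\ne i}=(\tau_j)_{j\ne i})$), the maximum pseudolikelihood estimator based on a single observation $\sigma$ is $\hat\beta_N=\inf\{x\ge0:L_\sigma(x)=0\}$, with the conventions $\hat\beta_N=0$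 if $L_\sigma(0)<0$ (the pseudolikelihood is then maximized over $[0,\infty)$ at $0$) and $\hat\beta_N=\infty$ if $L_\sigma(x)>0$ for all $x\ge0$. It is $b_N$-consistent at $\beta_0$ if $\limsup_{K\to\infty}\limsup_{N\to\infty}\mathbb{P}_{\beta_0}(b_N|\hat\beta_N-\beta_0|>K)=0$. *)

theory Defs
  imports "HOL-Probability.Probability" "Graph_Theory.Pair_Digraph"
begin

text \<open>
  A simple graph is a \<open>pair_graph\<close>: a finite loop-free digraph with a symmetric set of arcs, each
  undirected edge being represented by its two orientations.  The degree of a vertex is therefore its
  out-degree.
\<close>
definition regular_graph :: "nat \<Rightarrow> 'v pair_pre_digraph \<Rightarrow> bool" where
  "regular_graph d G \<longleftrightarrow> pair_graph G \<and> (\<forall>v\<in>pverts G. out_degree (with_proj G) v = d)"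

definition adjacency :: "'v pair_pre_digraph \<Rightarrow> 'v \<Rightarrow> 'v \<Rightarrow> real" where
  "adjacency G i j = of_bool ((i, j) \<in> parcs G)"

definition coupling :: "'v pair_pre_digraph \<Rightarrow> nat \<Rightarrow> 'v \<Rightarrow> 'v \<Rightarrow> real" where
  "coupling G d i j = adjacency G i j / real d"

definition spins :: "'v pair_pre_digraph \<Rightarrow> ('v \<Rightarrow> real) set" where
  "spins G = pverts G \<rightarrow>\<^sub>E {-1, 1}"

definition suff_stat :: "'v pair_pre_digraph \<Rightarrow> nat \<Rightarrow> ('v \<Rightarrow> real) \<Rightarrow> real" where
  "suff_stat G d \<tau> = (\<Sum>i\<in>pverts G. \<Sum>j\<in>pverts G. \<tau> i * coupling G d i j * \<tau> j)"

definition log_partition :: "'v pair_pre_digraph \<Rightarrow> nat \<Rightarrow> real \<Rightarrow> real" where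
  "log_partition G d \<beta> =
     ln ((1 / 2 ^ card (pverts G)) * (\<Sum>\<tau>\<in>spins G. exp (1 / 2 * \<beta> * suff_stat G d \<tau>)))"

definition ising_mass :: "'v pair_pre_digraph \<Rightarrow> nat \<Rightarrow> real \<Rightarrow> ('v \<Rightarrow> real) \<Rightarrow> real" where
  "ising_mass G d \<beta> \<tau> =
     (1 / 2 ^ card (pverts G)) * exp (1 / 2 * \<beta> * suff_stat G d \<tau> - log_partition G d \<beta>)"

definition ising :: "'v pair_pre_digraph \<Rightarrow> nat \<Rightarrow> real \<Rightarrow> ('v \<Rightarrow> real) pmf" where
  "ising G d \<beta> = embed_pmf (\<lambda>\<tau>. if \<tau> \<in> spins G then ising_mass G d \<beta> \<tau> else 0)"

definition local_field :: "'v pair_pre_digraph \<Rightarrow> nat \<Rightarrow> ('v \<Rightarrow> real) \<Rightarrow> 'v \<Rightarrow> real" where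
  "local_field G d \<tau> i = (\<Sum>j\<in>pverts G. coupling G d i j * \<tau> j)"

definition pl_score :: "'v pair_pre_digraph \<Rightarrow> nat \<Rightarrow> ('v \<Rightarrow> real) \<Rightarrow> real \<Rightarrow> real" where
  "pl_score G d \<tau> x =
     (1 / real (card (pverts G))) *
     (\<Sum>i\<in>pverts G. local_field G d \<tau> i * (\<tau> i - tanh (x * local_field G d \<tau> i)))"

definition mple :: "'v pair_pre_digraph \<Rightarrow> nat \<Rightarrow> ('v \<Rightarrow> real) \<Rightarrow> ereal" where
  "mple G d \<sigma> =
     (if pl_score G d \<sigma> 0 < 0 then 0
      else if \<forall>x\<ge>0. pl_score G d \<sigma> x > 0 then \<infinity>
      else Inf (ereal ` {x. x \<ge> 0 \<and> pl_score G d \<sigma> x = 0}))"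

text \<open>
  \<open>P N\<close> is the law of the \<open>N\<close>-th observation under the true parameter \<open>\<beta>\<^sub>0\<close>. The estimator is
  \<open>ereal\<close>-valued, so the value \<open>\<infinity>\<close> lies at infinite distance from \<open>\<beta>\<^sub>0\<close>.
\<close>
definition rate_consistent ::
    "(nat \<Rightarrow> real) \<Rightarrow> (nat \<Rightarrow> 'a pmf) \<Rightarrow> (nat \<Rightarrow> 'a \<Rightarrow> ereal) \<Rightarrow> real \<Rightarrow> bool" where
  "rate_consistent b P est \<beta>\<^sub>0 \<longleftrightarrow>
     Limsup at_top (\<lambda>K::real. Limsup sequentially (\<lambda>N.
       ereal (measure_pmf.prob (P N) {\<sigma>. ereal (b N) * \<bar>est N \<sigma> - ereal \<beta>\<^sub>0\<bar> > ereal K}))) = 0"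

text \<open>The argument of \<open>embed_pmf\<close> in \<open>ising\<close> is a probability mass function.\<close>

lemma finite_spins: "finite (pverts G) \<Longrightarrow> finite (spins G)"
  by (simp add: spins_def finite_PiE)

lemma spins_nonempty: "spins G \<noteq> {}"
  by (simp add: spins_def PiE_eq_empty_iff)

lemma sum_ising_mass:
  assumes "finite (pverts G)"
  shows "(\<Sum>\<tau>\<in>spins G. ising_mass G d \<beta> \<tau>) = 1"
proof -
  define Z where "Z = (\<Sum>\<tau>\<in>spins G. exp (1 / 2 * \<beta> * suff_stat G d \<tau>))"
  have Z: "Z > 0"
    unfolding Z_def using finite_spins[OF assms] spins_nonempty by (intro sum_pos) auto
  have "exp (log_partition G d \<beta>) = (1 / 2 ^ card (pverts G)) * Z"
    using Z by (simp add: log_partition_def Z_def)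
  then show ?thesis
    using Z by (simp add: ising_mass_def exp_diff sum_divide_distrib[symmetric] Z_def[symmetric]
        sum_distrib_left[symmetric] del: times_divide_eq_left)
qed

lemma pmf_ising:
  assumes "finite (pverts G)"
  shows "pmf (ising G d \<beta>) \<tau> = (if \<tau> \<in> spins G then ising_mass G d \<beta> \<tau> else 0)"
  unfolding ising_def
proof (rule pmf_embed_pmf)
  have nn: "ising_mass G d \<beta> \<sigma> \<ge> 0" for \<sigma>
    by (simp add: ising_mass_def)
  then show "0 \<le> (if \<sigma> \<in> spins G then ising_mass G d \<beta> \<sigma> else 0)" for \<sigma>
    by simp
  have "(\<integral>\<^sup>+ \<sigma>. ennreal (if \<sigma> \<in> spins G then ising_mass G d \<beta> \<sigma> else 0) \<partial>count_space UNIV)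
      = (\<Sum>\<sigma>\<in>spins G. ennreal (ising_mass G d \<beta> \<sigma>))"
    by (subst nn_integral_count_space'[OF finite_spins[OF assms]]) auto
  also have "\<dots> = 1"
    using nn by (simp add: sum_ennreal sum_ising_mass[OF assms])
  finally show "(\<integral>\<^sup>+ \<sigma>. ennreal (if \<sigma> \<in> spins G then ising_mass G d \<beta> \<sigma> else 0)
      \<partial>count_space UNIV) = 1" .
qed

end

theory Submission
  imports Defs "HOL-Real_Asymp.Real_Asymp"
begin

text \<open>
  Write \<open>m\<close> for the local fields, \<open>S = \<Sum>\<^sub>i m\<^sub>i (\<tau>\<^sub>i - tanh (\<beta> m\<^sub>i))\<close> for the unnormalised score at the
  true parameter, \<open>Q = \<Sum>\<^sub>i m\<^sub>i\<^sup>2\<close>, and let \<open>a = N / d\<close> at high and \<open>a = N\<close> at low temperature.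
  The score has slope at most \<open>-(1 - tanh\<^sup>2 B) Q\<close> as long as all \<open>x m\<^sub>i\<close> stay in \<open>[-B, B]\<close>, so the
  estimator is within \<open>K / \<surd>a\<close> of \<open>\<beta>\<close> once \<open>S = O(\<surd>a)\<close>, \<open>Q\<close> is at least of order \<open>a\<close>, and
  the fields are uniformly small enough.

  Since \<open>\<tau>\<^sub>i\<close> has conditional mean \<open>tanh (\<beta> m\<^sub>i)\<close>, replacing a function by half its difference under
  the flip of spin \<open>i\<close> gives \<open>E S\<^sup>2 \<le> C (E Q + N / d)\<close>, and for \<open>\<beta> < 1\<close> also
  \<open>E Q \<le> (N / d) / (1 - \<beta>)\<close>. For the lower bound on \<open>Q\<close> when \<open>a\<close> is large, the log-partition
  function is at least \<open>c a\<close> (high-temperature expansion for \<open>\<beta> < 1\<close>, a tilted product measure for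
  \<open>\<beta> > 1\<close>), so \<open>H\<close> is rarely below a multiple of \<open>a\<close>, while \<open>H \<le> S + \<beta> Q\<close>. When \<open>N / d\<close> stays
  bounded and \<open>\<beta> < 1\<close>, the model is contiguous to independent fair spins, for which
  \<open>Q \<ge> (\<Sum>\<^sub>i \<tau>\<^sub>i)\<^sup>2 / N\<close> does not concentrate at \<open>0\<close> and the maximal field tends to \<open>0\<close>; the latter
  keeps the slope bound valid on intervals of length \<open>K\<close>.
\<close>

section \<open>Estimates for real functions\<close>

lemma tanh_real_lipschitz: "\<bar>tanh x - tanh y\<bar> \<le> \<bar>x - y\<bar>" for x y :: real
proof -
  have *: "tanh y - tanh x \<le> y - x" if "x \<le> y" for x y :: real
  proof (cases "x = y")
    case False
    then have "x < y" using that by simp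
    have "\<exists>z>x. z < y \<and> tanh y - tanh x = (y - x) * (1 - tanh z ^ 2)"
      by (rule MVT2[OF \<open>x < y\<close>]) (auto intro!: derivative_eq_intros)
    then obtain z where "tanh y - tanh x = (y - x) * (1 - tanh z ^ 2)" by blast
    also have "\<dots> \<le> (y - x) * 1"
      using \<open>x < y\<close> by (intro mult_left_mono) auto
    finally show ?thesis by simp
  qed simp
  show ?thesis
    using *[of x y] *[of y x] by (cases x y rule: linorder_cases) (auto simp: abs_if)
qed

lemma abs_tanh_real_le: "\<bar>tanh x\<bar> \<le> \<bar>x\<bar>" for x :: real
  using tanh_real_lipschitz[of x 0] by simp

lemma tanh_sq_less_1: "(tanh x)\<^sup>2 < 1" for x :: real
  using tanh_real_bounds[of x] by (simp add: abs_square_less_1 abs_less_iff)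

text \<open>By the mean value theorem the increment is \<open>(y - x) * m\<^sup>2\<close> times a
  value of the derivative \<open>1 - tanh\<^sup>2\<close>, which on \<open>[-B, B]\<close> is
  smallest at the ends. This supplies the strict slope of the score.\<close>

lemma tanh_growth:
  fixes m x y B :: real
  assumes "0 \<le> x" "x \<le> y" "\<bar>y * m\<bar> \<le> B"
  shows "m * (tanh (y * m) - tanh (x * m)) \<ge> (y - x) * m\<^sup>2 * (1 - (tanh B)\<^sup>2)"
proof (cases "x = y")
  case False
  then have "x < y" using assms by simp
  have "\<exists>z>x. z < y \<and> m * tanh (y * m) - m * tanh (x * m) = (y - x) * (m * ((1 - tanh (z * m) ^ 2) * m))"
    by (rule MVT2[OF \<open>x < y\<close>]) (auto intro!: derivative_eq_intros simp: algebra_simps)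
  then obtain z where z: "x < z" "z < y"
    "m * tanh (y * m) - m * tanh (x * m) = (y - x) * (m * ((1 - tanh (z * m) ^ 2) * m))" by blast
  have "\<bar>z * m\<bar> \<le> B"
    using z assms mult_right_mono[of z y "\<bar>m\<bar>"] by (simp add: abs_mult)
  then have "tanh \<bar>z * m\<bar> \<le> tanh \<bar>B\<bar>"
    by (subst tanh_real_le_iff) linarith
  then have "\<bar>tanh (z * m)\<bar> \<le> \<bar>tanh B\<bar>"
    by (simp only: tanh_real_abs)
  then have "tanh (z * m) ^ 2 \<le> tanh B ^ 2"
    by (simp add: abs_le_square_iff)
  then have "(y - x) * m\<^sup>2 * (1 - (tanh B)\<^sup>2) \<le> (y - x) * m\<^sup>2 * (1 - (tanh (z * m))\<^sup>2)"
    using z by (intro mult_left_mono) auto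
  also have "\<dots> = m * tanh (y * m) - m * tanh (x * m)"
    using z by (simp add: power2_eq_square algebra_simps)
  finally show ?thesis by (simp add: algebra_simps)
qed simp

text \<open>The bound keeps a factor \<open>\<bar>x\<bar> + \<bar>y\<bar>\<close> instead of a
  constant. When one spin flips, the change of the score is thus measured by the fields, and its
  second moment by the field energy.\<close>

lemma mult_tanh_lipschitz:
  fixes \<beta> x y :: real
  assumes "\<beta> \<ge> 0"
  shows "\<bar>x * tanh (\<beta> * x) - y * tanh (\<beta> * y)\<bar> \<le> \<beta> * (\<bar>x\<bar> + \<bar>y\<bar>) * \<bar>x - y\<bar>"
proof -
  have "x * tanh (\<beta> * x) - y * tanh (\<beta> * y)
      = x * (tanh (\<beta> * x) - tanh (\<beta> * y)) + (x - y) * tanh (\<beta> * y)"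
    by (simp add: algebra_simps)
  also have "\<bar>\<dots>\<bar> \<le> \<bar>x\<bar> * \<bar>tanh (\<beta> * x) - tanh (\<beta> * y)\<bar> + \<bar>x - y\<bar> * \<bar>tanh (\<beta> * y)\<bar>"
    by (metis abs_mult abs_triangle_ineq)
  also have "\<dots> \<le> \<bar>x\<bar> * \<bar>\<beta> * x - \<beta> * y\<bar> + \<bar>x - y\<bar> * \<bar>\<beta> * y\<bar>"
    by (intro add_mono mult_left_mono tanh_real_lipschitz abs_tanh_real_le) auto
  also have "\<bar>\<beta> * x - \<beta> * y\<bar> = \<beta> * \<bar>x - y\<bar>"
    using assms by (metis abs_mult abs_of_nonneg right_diff_distrib)
  also have "\<bar>x\<bar> * (\<beta> * \<bar>x - y\<bar>) + \<bar>x - y\<bar> * \<bar>\<beta> * y\<bar> = \<beta> * (\<bar>x\<bar> + \<bar>y\<bar>) * \<bar>x - y\<bar>"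
    using assms by (simp add: abs_mult distrib_left distrib_right)
  finally show ?thesis .
qed

section \<open>The Ising model on a regular graph\<close>

definition flip :: "'v \<Rightarrow> ('v \<Rightarrow> real) \<Rightarrow> 'v \<Rightarrow> real" where
  "flip i \<tau> = \<tau>(i := - \<tau> i)"

lemma flip_flip [simp]: "flip i (flip i \<tau>) = \<tau>"
  by (auto simp: flip_def)

lemma flip_same [simp]: "flip i \<tau> i = - \<tau> i"
  by (simp add: flip_def)

lemma flip_other [simp]: "j \<noteq> i \<Longrightarrow> flip i \<tau> j = \<tau> j"
  by (simp add: flip_def)

lemma spins_cases: "\<tau> \<in> spins G \<Longrightarrow> i \<in> pverts G \<Longrightarrow> \<tau> i = -1 \<or> \<tau> i = 1"
  by (auto simp: spins_def PiE_def Pi_def)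

lemma spins_sq: "\<tau> \<in> spins G \<Longrightarrow> i \<in> pverts G \<Longrightarrow> \<tau> i * \<tau> i = 1"
  using spins_cases by fastforce

lemma spins_abs: "\<tau> \<in> spins G \<Longrightarrow> i \<in> pverts G \<Longrightarrow> \<bar>\<tau> i\<bar> = 1"
  using spins_cases by fastforce

lemma flip_spins: "\<tau> \<in> spins G \<Longrightarrow> i \<in> pverts G \<Longrightarrow> flip i \<tau> \<in> spins G"
  by (auto simp: spins_def PiE_iff flip_def extensional_def)

lemma sum_spins_flip:
  assumes "i \<in> pverts G"
  shows "(\<Sum>\<tau>\<in>spins G. f (flip i \<tau>)) = (\<Sum>\<tau>\<in>spins G. f \<tau>)"
  by (rule sum.reindex_bij_witness[of _ "flip i" "flip i"]) (auto intro: flip_spins assms)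

text \<open>Flipping spin \<open>i\<close> is an involution of \<open>spins G\<close>, so the sum
  equals its own negative. Conditional expectations, under the Ising measure as well as under
  product measures, are evaluated this way.\<close>

lemma sum_spins_odd:
  fixes f :: "('v \<Rightarrow> real) \<Rightarrow> real"
  assumes "i \<in> pverts G" and "\<And>\<tau>. \<tau> \<in> spins G \<Longrightarrow> f (flip i \<tau>) = - f \<tau>"
  shows "(\<Sum>\<tau>\<in>spins G. f \<tau>) = 0"
proof -
  have "(\<Sum>\<tau>\<in>spins G. f \<tau>) = (\<Sum>\<tau>\<in>spins G. f (flip i \<tau>))"
    by (rule sum_spins_flip[OF assms(1), symmetric])
  also have "\<dots> = - (\<Sum>\<tau>\<in>spins G. f \<tau>)"
    by (simp add: assms(2) sum_negf cong: sum.cong)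
  finally show ?thesis by simp
qed

lemma sum_spins_prod:
  fixes f :: "'v \<Rightarrow> real \<Rightarrow> real"
  assumes "finite (pverts G)"
  shows "(\<Sum>\<tau>\<in>spins G. \<Prod>i\<in>pverts G. f i (\<tau> i)) = (\<Prod>i\<in>pverts G. f i (-1) + f i 1)"
  unfolding spins_def using assms by (subst prod_sum_PiE[symmetric]) auto

lemma card_spins: "finite (pverts G) \<Longrightarrow> real (card (spins G)) = 2 ^ card (pverts G)"
  using sum_spins_prod[of G "\<lambda>_ _. 1"] by simp

locale regular_ising =
  fixes G :: "'v pair_pre_digraph" and d :: nat and \<beta> :: real
  assumes regular: "regular_graph d G" and d_pos: "d \<ge> 1"
    and nonempty: "pverts G \<noteq> {}" and \<beta>_nonneg: "\<beta> \<ge> 0"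
begin

abbreviation "V \<equiv> pverts G"
abbreviation "W \<equiv> spins G"
abbreviation "J \<equiv> coupling G d"
abbreviation "H \<equiv> suff_stat G d"
abbreviation "m \<equiv> local_field G d"
abbreviation "n \<equiv> real (card V)"

text \<open>Kept as a finite sum, so that linearity and flip arguments are plain manipulations of
  sums; \<open>prob_eq\<close> connects it with the pmf.\<close>

definition mean :: "(('v \<Rightarrow> real) \<Rightarrow> real) \<Rightarrow> real" where
  "mean f = (\<Sum>\<tau>\<in>W. ising_mass G d \<beta> \<tau> * f \<tau>)"

definition field_energy :: "('v \<Rightarrow> real) \<Rightarrow> real" where
  "field_energy \<tau> = (\<Sum>i\<in>V. (m \<tau> i)\<^sup>2)"

definition score :: "('v \<Rightarrow> real) \<Rightarrow> real" where
  "score \<tau> = (\<Sum>i\<in>V. m \<tau> i * (\<tau> i - tanh (\<beta> * m \<tau> i)))"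

section \<open>The coupling matrix and the local fields\<close>

lemma pair_graph: "pair_graph G"
  using regular by (simp add: regular_graph_def)

lemma finite_V [simp, intro]: "finite V"
  using pair_graph by (simp add: pair_graph_def pair_digraph_def pair_fin_digraph_def pair_fin_digraph_axioms_def)

lemma finite_W [simp, intro]: "finite W"
  by (simp add: finite_spins)

lemma card_V_pos: "0 < n"
  using nonempty by (simp add: card_gt_0_iff)

lemma arc_verts: "(i, j) \<in> parcs G \<Longrightarrow> i \<in> V \<and> j \<in> V"
proof -
  interpret pair_graph G by (rule pair_graph)
  show "(i, j) \<in> parcs G \<Longrightarrow> i \<in> V \<and> j \<in> V"
    using arc_fst_in_verts arc_snd_in_verts by fastforce
qed

lemma arc_sym: "(i, j) \<in> parcs G \<longleftrightarrow> (j, i) \<in> parcs G"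
proof -
  interpret pair_graph G by (rule pair_graph)
  show ?thesis using pair_sym_arcs
    by (auto simp: symmetric_def sym_def parcs_def arcs_ends_def arc_to_ends_def image_def)
qed

lemma no_loop: "(i, i) \<notin> parcs G"
proof -
  interpret pair_graph G by (rule pair_graph)
  show ?thesis using pair_no_loops by fastforce
qed

lemma card_arcs_from: "i \<in> V \<Longrightarrow> card {j. (i, j) \<in> parcs G} = d"
proof -
  assume "i \<in> V"
  then have "d = out_degree (with_proj G) i"
    using regular by (simp add: regular_graph_def)
  also have "\<dots> = card (Pair i ` {j. (i, j) \<in> parcs G})"
    unfolding out_degree_def out_arcs_def by (rule arg_cong[where f = card]) force
  also have "\<dots> = card {j. (i, j) \<in> parcs G}"
    by (rule card_image) (auto simp: inj_on_def)
  finally show ?thesis by simp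
qed

lemma coupling_sym: "J i j = J j i"
  using arc_sym by (simp add: coupling_def adjacency_def)

lemma coupling_diag [simp]: "J i i = 0"
  using no_loop by (simp add: coupling_def adjacency_def)

lemma coupling_nonneg: "0 \<le> J i j"
  by (simp add: coupling_def adjacency_def)

lemma sum_adjacency: "i \<in> V \<Longrightarrow> (\<Sum>j\<in>V. adjacency G i j) = real d"
proof -
  assume "i \<in> V"
  have "(\<Sum>j\<in>V. adjacency G i j) = real (card {j \<in> V. (i, j) \<in> parcs G})"
    by (simp add: adjacency_def of_bool_def sum.If_cases Collect_conj_eq)
  also have "{j \<in> V. (i, j) \<in> parcs G} = {j. (i, j) \<in> parcs G}"
    using arc_verts by auto
  finally show ?thesis using card_arcs_from[OF \<open>i \<in> V\<close>] by simp
qed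

lemma sum_coupling: "i \<in> V \<Longrightarrow> (\<Sum>j\<in>V. J i j) = 1"
  using sum_adjacency[of i] d_pos by (simp add: coupling_def sum_divide_distrib[symmetric])

lemma coupling_sq: "J i j * J i j = J i j / d"
  by (simp add: coupling_def adjacency_def)

lemma sum_coupling_sq: "i \<in> V \<Longrightarrow> (\<Sum>j\<in>V. J i j * J i j) = 1 / d"
  by (simp only: coupling_sq sum_divide_distrib[symmetric] sum_coupling)

lemma coupling_le: "J i j \<le> 1 / d"
  by (simp add: coupling_def adjacency_def divide_right_mono)

lemma degree_le: "real d \<le> n"
proof -
  obtain i where i: "i \<in> V" using nonempty by auto
  have "1 \<le> n * (1 / d)"
    using sum_bounded_above[of V "J i" "1 / d"] coupling_le sum_coupling[OF i] by simp
  then show ?thesis using d_pos by (simp add: field_simps)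
qed

lemma size_ratio_ge_1: "1 \<le> n / d"
  using degree_le d_pos by simp

lemma abs_field_le_1: "\<tau> \<in> W \<Longrightarrow> i \<in> V \<Longrightarrow> \<bar>m \<tau> i\<bar> \<le> 1"
proof -
  assume *: "\<tau> \<in> W" "i \<in> V"
  have "\<bar>m \<tau> i\<bar> \<le> (\<Sum>j\<in>V. \<bar>J i j * \<tau> j\<bar>)"
    unfolding local_field_def by (rule sum_abs)
  also have "\<dots> = (\<Sum>j\<in>V. J i j)"
    using * by (intro sum.cong) (auto simp: abs_mult spins_abs coupling_nonneg)
  finally show ?thesis using * by (simp add: sum_coupling)
qed

lemma suff_stat_eq: "H \<tau> = (\<Sum>i\<in>V. m \<tau> i * \<tau> i)"
  by (simp add: suff_stat_def local_field_def sum_distrib_left sum_distrib_right mult_ac)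

lemma field_flip: "i \<in> V \<Longrightarrow> m (flip i \<tau>) j = m \<tau> j - 2 * J j i * \<tau> i"
proof -
  assume i: "i \<in> V"
  have "m (flip i \<tau>) j = J j i * (- \<tau> i) + (\<Sum>k\<in>V - {i}. J j k * \<tau> k)"
    unfolding local_field_def by (subst sum.remove[OF finite_V i]) (auto intro: sum.cong)
  also have "(\<Sum>k\<in>V - {i}. J j k * \<tau> k) = m \<tau> j - J j i * \<tau> i"
    unfolding local_field_def by (subst sum.remove[OF finite_V i]) auto
  finally show ?thesis by simp
qed

lemma field_flip_same [simp]: "i \<in> V \<Longrightarrow> m (flip i \<tau>) i = m \<tau> i"
  by (simp add: field_flip)

lemma sum_coupling_swap: "(\<Sum>i\<in>V. x i * (\<Sum>j\<in>V. J i j * y j)) = (\<Sum>j\<in>V. y j * (\<Sum>i\<in>V. J j i * x i))"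
  unfolding sum_distrib_left
  by (subst sum.swap) (auto intro!: sum.cong simp: coupling_sym mult_ac)

text \<open>Spin \<open>i\<close> enters \<open>H\<close> through row \<open>i\<close> and through
  column \<open>i\<close> of the symmetric coupling matrix, each contributing
  \<open>\<tau> i * m \<tau> i\<close>. The flip reverses both, hence the 4.\<close>

lemma suff_stat_flip:
  assumes i: "i \<in> V"
  shows "H (flip i \<tau>) = H \<tau> - 4 * \<tau> i * m \<tau> i"
proof -
  have "H (flip i \<tau>) = (\<Sum>j\<in>V. m (flip i \<tau>) j * \<tau> j) - 2 * m \<tau> i * \<tau> i"
    unfolding suff_stat_eq
    by (subst (1 2) sum.remove[OF finite_V i]) (use i in \<open>auto simp: algebra_simps intro!: sum.cong\<close>)
  also have "(\<Sum>j\<in>V. m (flip i \<tau>) j * \<tau> j) = H \<tau> - 2 * \<tau> i * (\<Sum>j\<in>V. J i j * \<tau> j)"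
    using i by (simp add: field_flip suff_stat_eq algebra_simps sum_subtractf sum_distrib_left coupling_sym)
  finally show ?thesis by (simp add: local_field_def algebra_simps)
qed

section \<open>Expectations and conditional means under the Ising measure\<close>

lemma mass_nonneg: "0 \<le> ising_mass G d \<beta> \<tau>"
  by (simp add: ising_mass_def)

lemma mean_const: "mean (\<lambda>_. c) = c"
  by (simp add: mean_def sum_distrib_right[symmetric] sum_ising_mass)

lemma mean_add: "mean (\<lambda>\<tau>. f \<tau> + g \<tau>) = mean f + mean g"
  by (simp add: mean_def sum.distrib algebra_simps)

lemma mean_diff: "mean (\<lambda>\<tau>. f \<tau> - g \<tau>) = mean f - mean g"
  by (simp add: mean_def sum_subtractf algebra_simps)

lemma mean_cmult: "mean (\<lambda>\<tau>. c * f \<tau>) = c * mean f"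
  by (simp add: mean_def sum_distrib_left algebra_simps)

lemma mean_sum: "mean (\<lambda>\<tau>. \<Sum>i\<in>I. f i \<tau>) = (\<Sum>i\<in>I. mean (f i))"
  by (simp add: mean_def sum_distrib_left sum.swap[of _ I])

lemma mean_mono: "(\<And>\<tau>. \<tau> \<in> W \<Longrightarrow> f \<tau> \<le> g \<tau>) \<Longrightarrow> mean f \<le> mean g"
  unfolding mean_def by (intro sum_mono mult_left_mono mass_nonneg) auto

lemma mean_cong: "(\<And>\<tau>. \<tau> \<in> W \<Longrightarrow> f \<tau> = g \<tau>) \<Longrightarrow> mean f = mean g"
  unfolding mean_def by (intro sum.cong) auto

lemma prob_eq: "measure_pmf.prob (ising G d \<beta>) A = mean (indicator A)"
proof -
  have "set_pmf (ising G d \<beta>) \<subseteq> W"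
    by (auto simp: set_pmf_iff pmf_ising split: if_splits)
  then have "measure_pmf.prob (ising G d \<beta>) A = measure_pmf.prob (ising G d \<beta>) (A \<inter> W)"
    by (intro measure_pmf.finite_measure_eq_AE) (auto simp: AE_measure_pmf_iff)
  also have "\<dots> = (\<Sum>\<tau>\<in>A \<inter> W. pmf (ising G d \<beta>) \<tau>)"
    by (rule measure_measure_pmf_finite) auto
  also have "\<dots> = (\<Sum>\<tau>\<in>A \<inter> W. ising_mass G d \<beta> \<tau>)"
    by (rule sum.cong) (auto simp: pmf_ising)
  also have "\<dots> = mean (indicator A)"
    unfolding mean_def by (rule sum.mono_neutral_cong_left) (auto simp: indicator_def)
  finally show ?thesis .
qed

text \<open>Given the other spins, \<open>\<tau> i\<close> has weight proportional to
  \<open>exp (x * \<tau> i)\<close> with \<open>x = \<beta> * m \<tau> i\<close>, and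
  \<open>m \<tau> i\<close> ignores the flip because the diagonal of \<open>J\<close> vanishes.
  Multiplied by \<open>\<tau> i - tanh x\<close> this weight becomes
  \<open>\<tau> i / cosh x\<close>, which is odd.\<close>

lemma mass_flip:
  assumes i: "i \<in> V" and \<tau>: "\<tau> \<in> W"
  shows "ising_mass G d \<beta> (flip i \<tau>) * (- \<tau> i - tanh (\<beta> * m \<tau> i))
       = - (ising_mass G d \<beta> \<tau> * (\<tau> i - tanh (\<beta> * m \<tau> i)))"
proof -
  define x where "x = \<beta> * m \<tau> i"
  \<comment> \<open>The geometric mean of the weights of \<open>\<tau>\<close> and
    \<open>flip i \<tau>\<close>; these differ from it by the factors
    \<open>exp (x * \<tau> i)\<close> and \<open>exp (- x * \<tau> i)\<close>.\<close>
  define w where "w = (1 / 2 ^ card V) * exp (1 / 2 * \<beta> * H \<tau> - \<beta> * m \<tau> i * \<tau> i - log_partition G d \<beta>)"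
  have 1: "ising_mass G d \<beta> \<tau> = w * exp (x * \<tau> i)"
    by (simp add: ising_mass_def w_def x_def exp_diff exp_add[symmetric] exp_minus field_simps)
  have 2: "ising_mass G d \<beta> (flip i \<tau>) = w * exp (- x * \<tau> i)"
    by (simp add: ising_mass_def w_def x_def mult_exp_exp suff_stat_flip[OF i] algebra_simps)
  have "cosh x \<noteq> 0" by simp
  then have t: "tanh x = (exp x - exp (-x)) / (exp x + exp (-x))"
    by (simp add: tanh_altdef)
  have ne: "exp x + exp (-x) \<noteq> 0"
    by (smt (verit) exp_gt_zero)
  show ?thesis
    unfolding 1 2 x_def[symmetric] t
    using spins_cases[OF \<tau> i] ne by (auto simp: field_simps)
qed

text \<open>A function that ignores the flip depends on the other spins only, and given those, spin
  \<open>i\<close> has mean \<open>tanh (\<beta> * m \<tau> i)\<close>.\<close>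

lemma conditional_mean:
  assumes i: "i \<in> V" and g: "\<And>\<tau>. \<tau> \<in> W \<Longrightarrow> g (flip i \<tau>) = g \<tau>"
  shows "mean (\<lambda>\<tau>. (\<tau> i - tanh (\<beta> * m \<tau> i)) * g \<tau>) = 0"
  unfolding mean_def
proof (rule sum_spins_odd[OF i])
  fix \<tau> assume \<tau>: "\<tau> \<in> W"
  show "ising_mass G d \<beta> (flip i \<tau>) * ((flip i \<tau> i - tanh (\<beta> * m (flip i \<tau>) i)) * g (flip i \<tau>))
      = - (ising_mass G d \<beta> \<tau> * ((\<tau> i - tanh (\<beta> * m \<tau> i)) * g \<tau>))"
    using mass_flip[OF i \<tau>] i by (simp add: g[OF \<tau>] mult.assoc[symmetric] mult_minus_left)
qed

text \<open>Only the part of \<open>g\<close> that is odd under the flip survives; the even part is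
  annihilated by \<open>conditional_mean\<close>. A global quantity is thereby replaced by its
  response to one spin.\<close>

lemma conditional_mean_flip:
  assumes i: "i \<in> V"
  shows "mean (\<lambda>\<tau>. (\<tau> i - tanh (\<beta> * m \<tau> i)) * g \<tau>)
    = mean (\<lambda>\<tau>. (\<tau> i - tanh (\<beta> * m \<tau> i)) * ((g \<tau> - g (flip i \<tau>)) / 2))"
proof -
  have "mean (\<lambda>\<tau>. (\<tau> i - tanh (\<beta> * m \<tau> i)) * g \<tau>)
      = mean (\<lambda>\<tau>. (\<tau> i - tanh (\<beta> * m \<tau> i)) * ((g \<tau> + g (flip i \<tau>)) / 2))
      + mean (\<lambda>\<tau>. (\<tau> i - tanh (\<beta> * m \<tau> i)) * ((g \<tau> - g (flip i \<tau>)) / 2))"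
    unfolding mean_add[symmetric] by (rule mean_cong) (simp add: field_simps)
  also have "mean (\<lambda>\<tau>. (\<tau> i - tanh (\<beta> * m \<tau> i)) * ((g \<tau> + g (flip i \<tau>)) / 2)) = 0"
    by (rule conditional_mean[OF i]) simp
  finally show ?thesis by simp
qed

end

section \<open>Second moments of the score and of the local fields\<close>

context regular_ising
begin

text \<open>\<open>J\<close> is symmetric and nonnegative with unit row sums, so the inequality
  \<open>2 * x * y \<le> x\<^sup>2 + y\<^sup>2\<close>, applied entrywise, shows that its operator
  norm is at most 1.\<close>

lemma coupling_form_le:
  "(\<Sum>i\<in>V. x i * (\<Sum>j\<in>V. J i j * y j)) \<le> ((\<Sum>i\<in>V. (x i)\<^sup>2) + (\<Sum>i\<in>V. (y i)\<^sup>2)) / 2"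
proof -
  have "x i * (J i j * y j) \<le> J i j * ((x i)\<^sup>2 / 2) + J i j * ((y j)\<^sup>2 / 2)" for i j
    using mult_left_mono[OF sum_squares_bound[of "x i" "y j"] coupling_nonneg[of i j]]
    by (simp add: algebra_simps)
  then have "(\<Sum>i\<in>V. x i * (\<Sum>j\<in>V. J i j * y j))
      \<le> (\<Sum>i\<in>V. \<Sum>j\<in>V. J i j * ((x i)\<^sup>2 / 2) + J i j * ((y j)\<^sup>2 / 2))"
    unfolding sum_distrib_left by (intro sum_mono)
  also have "\<dots> = (\<Sum>i\<in>V. (\<Sum>j\<in>V. J i j) * ((x i)\<^sup>2 / 2)) + (\<Sum>j\<in>V. (\<Sum>i\<in>V. J j i) * ((y j)\<^sup>2 / 2))"
    unfolding sum_distrib_right sum.distrib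
    by (subst (2) sum.swap) (simp add: coupling_sym)
  also have "\<dots> = ((\<Sum>i\<in>V. (x i)\<^sup>2) + (\<Sum>i\<in>V. (y i)\<^sup>2)) / 2"
    by (simp add: sum_coupling sum_divide_distrib[symmetric] add_divide_distrib)
  finally show ?thesis .
qed

lemma score_eq: "score \<tau> = H \<tau> - (\<Sum>i\<in>V. m \<tau> i * tanh (\<beta> * m \<tau> i))"
  by (simp add: score_def suff_stat_eq sum_subtractf algebra_simps)

text \<open>\<open>H\<close> changes by \<open>4 * \<tau> i * m \<tau> i\<close>, and each field
  \<open>m \<tau> j\<close> moves by \<open>2 * J i j\<close> in absolute value.
  \<open>mult_tanh_lipschitz\<close> turns the latter into an average of the neighbouring fields
  plus squared couplings, which sum to \<open>1 / d\<close>.\<close>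

lemma score_flip:
  assumes i: "i \<in> V" and \<tau>: "\<tau> \<in> W"
  shows "\<bar>score \<tau> - score (flip i \<tau>)\<bar>
    \<le> 4 * \<bar>m \<tau> i\<bar> + 4 * \<beta> * (\<Sum>j\<in>V. J i j * \<bar>m \<tau> j\<bar>) + 4 * \<beta> / d"
proof -
  let ?\<phi> = "\<lambda>x. x * tanh (\<beta> * x)"
  have one: "\<bar>?\<phi> (m (flip i \<tau>) j) - ?\<phi> (m \<tau> j)\<bar> \<le> 4 * \<beta> * (J i j * \<bar>m \<tau> j\<bar>) + 4 * \<beta> * (J i j * J i j)"
    if j: "j \<in> V" for j
  proof -
    have diff: "\<bar>m (flip i \<tau>) j - m \<tau> j\<bar> = 2 * J i j"
      using i spins_abs[OF \<tau> i] coupling_nonneg[of j i] coupling_sym[of i j]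
      by (simp add: field_flip abs_mult)
    have "\<bar>?\<phi> (m (flip i \<tau>) j) - ?\<phi> (m \<tau> j)\<bar>
        \<le> \<beta> * (\<bar>m (flip i \<tau>) j\<bar> + \<bar>m \<tau> j\<bar>) * (2 * J i j)"
      using mult_tanh_lipschitz[OF \<beta>_nonneg] diff by metis
    also have "\<dots> \<le> \<beta> * (2 * \<bar>m \<tau> j\<bar> + 2 * J i j) * (2 * J i j)"
      using diff \<beta>_nonneg coupling_nonneg[of i j] by (intro mult_right_mono mult_left_mono) auto
    finally show ?thesis by (simp add: algebra_simps)
  qed
  have "score \<tau> - score (flip i \<tau>) = 4 * \<tau> i * m \<tau> i + (\<Sum>j\<in>V. ?\<phi> (m (flip i \<tau>) j) - ?\<phi> (m \<tau> j))"
    using i by (simp add: score_eq suff_stat_flip sum_subtractf)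
  then have "\<bar>score \<tau> - score (flip i \<tau>)\<bar> \<le> \<bar>4 * \<tau> i * m \<tau> i\<bar> + (\<Sum>j\<in>V. \<bar>?\<phi> (m (flip i \<tau>) j) - ?\<phi> (m \<tau> j)\<bar>)"
    by (simp only:) (rule order_trans[OF abs_triangle_ineq add_left_mono[OF sum_abs]])
  also have "\<dots> \<le> 4 * \<bar>m \<tau> i\<bar> + (\<Sum>j\<in>V. 4 * \<beta> * (J i j * \<bar>m \<tau> j\<bar>) + 4 * \<beta> * (J i j * J i j))"
    using one spins_abs[OF \<tau> i] by (intro add_mono sum_mono) (auto simp: abs_mult)
  also have "\<dots> = 4 * \<bar>m \<tau> i\<bar> + 4 * \<beta> * (\<Sum>j\<in>V. J i j * \<bar>m \<tau> j\<bar>) + 4 * \<beta> / d"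
    using sum_coupling_sq[OF i] by (simp add: sum.distrib sum_distrib_left[symmetric])
  finally show ?thesis .
qed

text \<open>One factor of the squared score is expanded over the vertices. Since
  \<open>m \<tau> i\<close> ignores the flip at \<open>i\<close>,
  \<open>conditional_mean_flip\<close> leaves only the change of the other factor.
  \<open>score_flip\<close> bounds this change by local quantities, and
  \<open>coupling_form_le\<close> sums the neighbour averages.\<close>

lemma mean_score_sq_le:
  "mean (\<lambda>\<tau>. (score \<tau>)\<^sup>2) \<le> (4 + 6 * \<beta>) * mean field_energy + 2 * \<beta> * (n / d)"
proof -
  let ?r = "\<lambda>\<tau> i. \<tau> i - tanh (\<beta> * m \<tau> i)"
  have "mean (\<lambda>\<tau>. (score \<tau>)\<^sup>2) = mean (\<lambda>\<tau>. \<Sum>i\<in>V. ?r \<tau> i * (m \<tau> i * score \<tau>))"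
    by (rule mean_cong) (simp add: power2_eq_square score_def sum_product sum_distrib_left sum_distrib_right mult_ac)
  also have "\<dots> = (\<Sum>i\<in>V. mean (\<lambda>\<tau>. ?r \<tau> i * (m \<tau> i * score \<tau>)))"
    by (rule mean_sum)
  also have "\<dots> = (\<Sum>i\<in>V. mean (\<lambda>\<tau>. ?r \<tau> i * ((m \<tau> i * score \<tau> - m \<tau> i * score (flip i \<tau>)) / 2)))"
    by (intro sum.cong refl) (subst conditional_mean_flip, auto)
  also have "\<dots> = mean (\<lambda>\<tau>. \<Sum>i\<in>V. ?r \<tau> i * ((m \<tau> i * score \<tau> - m \<tau> i * score (flip i \<tau>)) / 2))"
    by (rule mean_sum[symmetric])
  also have "\<dots> \<le> mean (\<lambda>\<tau>. (4 + 6 * \<beta>) * field_energy \<tau> + 2 * \<beta> * (n / d))"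
  proof (rule mean_mono)
    fix \<tau> assume \<tau>: "\<tau> \<in> W"
    have "?r \<tau> i * ((m \<tau> i * score \<tau> - m \<tau> i * score (flip i \<tau>)) / 2)
        \<le> 4 * (m \<tau> i)\<^sup>2 + 4 * \<beta> * (\<bar>m \<tau> i\<bar> * (\<Sum>j\<in>V. J i j * \<bar>m \<tau> j\<bar>))
          + 2 * \<beta> * ((m \<tau> i)\<^sup>2 + 1 / d)" if i: "i \<in> V" for i
    proof -
      have r: "\<bar>?r \<tau> i\<bar> \<le> 2"
        using spins_abs[OF \<tau> i] tanh_real_bounds[of "\<beta> * m \<tau> i"] by (auto simp: abs_if split: if_splits)
      have "?r \<tau> i * ((m \<tau> i * score \<tau> - m \<tau> i * score (flip i \<tau>)) / 2)
          \<le> \<bar>?r \<tau> i\<bar> * (\<bar>m \<tau> i\<bar> * \<bar>score \<tau> - score (flip i \<tau>)\<bar> / 2)"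
        by (rule order_trans[OF abs_ge_self]) (simp add: abs_mult right_diff_distrib[symmetric])
      also have "\<dots> \<le> 2 * (\<bar>m \<tau> i\<bar> * (4 * \<bar>m \<tau> i\<bar> + 4 * \<beta> * (\<Sum>j\<in>V. J i j * \<bar>m \<tau> j\<bar>) + 4 * \<beta> / d) / 2)"
        by (intro mult_mono divide_right_mono mult_left_mono r score_flip[OF i \<tau>]) auto
      also have "\<dots> = 4 * (m \<tau> i)\<^sup>2 + 4 * \<beta> * (\<bar>m \<tau> i\<bar> * (\<Sum>j\<in>V. J i j * \<bar>m \<tau> j\<bar>)) + 2 * \<beta> * (2 * \<bar>m \<tau> i\<bar> / d)"
        by (simp add: power2_eq_square algebra_simps)
      \<comment> \<open>The remainder is linear in the field; split this way, with
        \<open>1 / d\<^sup>2 \<le> 1 / d\<close>, it sums to the field energy plus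
        \<open>n / d\<close>.\<close>
      also have "2 * \<bar>m \<tau> i\<bar> / d \<le> (m \<tau> i)\<^sup>2 + 1 / d"
      proof -
        have "2 * \<bar>m \<tau> i\<bar> * (1 / d) \<le> (m \<tau> i)\<^sup>2 + (1 / d)\<^sup>2"
          using sum_squares_bound[of "\<bar>m \<tau> i\<bar>" "1 / d"] by (simp add: power2_abs)
        also have "(1 / real d)\<^sup>2 \<le> 1 / d"
          using d_pos by (simp add: power2_eq_square field_simps)
        finally show ?thesis by simp
      qed
      finally show ?thesis using \<beta>_nonneg by (simp add: mult_left_mono)
    qed
    then have "(\<Sum>i\<in>V. ?r \<tau> i * ((m \<tau> i * score \<tau> - m \<tau> i * score (flip i \<tau>)) / 2))
        \<le> (\<Sum>i\<in>V. 4 * (m \<tau> i)\<^sup>2 + 4 * \<beta> * (\<bar>m \<tau> i\<bar> * (\<Sum>j\<in>V. J i j * \<bar>m \<tau> j\<bar>))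
          + 2 * \<beta> * ((m \<tau> i)\<^sup>2 + 1 / d))"
      by (rule sum_mono)
    also have "\<dots> = 4 * field_energy \<tau> + 4 * \<beta> * (\<Sum>i\<in>V. \<bar>m \<tau> i\<bar> * (\<Sum>j\<in>V. J i j * \<bar>m \<tau> j\<bar>))
        + 2 * \<beta> * (field_energy \<tau> + n / d)"
      by (simp add: sum.distrib sum_distrib_left[symmetric] field_energy_def)
    also have "\<dots> \<le> 4 * field_energy \<tau> + 4 * \<beta> * field_energy \<tau> + 2 * \<beta> * (field_energy \<tau> + n / d)"
      using coupling_form_le[of "\<lambda>i. \<bar>m \<tau> i\<bar>" "\<lambda>i. \<bar>m \<tau> i\<bar>"] \<beta>_nonneg
      by (intro add_mono mult_left_mono order_refl) (auto simp: field_energy_def)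
    finally show "(\<Sum>i\<in>V. ?r \<tau> i * ((m \<tau> i * score \<tau> - m \<tau> i * score (flip i \<tau>)) / 2))
        \<le> (4 + 6 * \<beta>) * field_energy \<tau> + 2 * \<beta> * (n / d)"
      by (simp add: algebra_simps)
  qed
  also have "\<dots> = (4 + 6 * \<beta>) * mean field_energy + 2 * \<beta> * (n / d)"
    by (simp add: mean_add mean_cmult mean_const)
  finally show ?thesis .
qed

lemma field_energy_le: "\<tau> \<in> W \<Longrightarrow> field_energy \<tau> \<le> n"
proof -
  assume \<tau>: "\<tau> \<in> W"
  have "field_energy \<tau> \<le> (\<Sum>i\<in>V. 1)"
    unfolding field_energy_def using abs_field_le_1[OF \<tau>] by (intro sum_mono) (simp add: abs_square_le_1)
  then show ?thesis by simp
qed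

text \<open>A self-bounding argument. The field energy \<open>Q\<close> is the sum of
  \<open>\<tau> i\<close> times \<open>(J m) i\<close>. Once the diagonal contribution, in total
  \<open>n / d\<close>, is split off, \<open>\<tau> i\<close> may be replaced by its conditional
  mean, of size at most \<open>\<beta> * \<bar>m \<tau> i\<bar>\<close>. This gives
  \<open>E Q \<le> n / d + \<beta> * E Q\<close>, which is solved for \<open>E Q\<close>.\<close>

lemma mean_field_energy_le:
  assumes "\<beta> < 1"
  shows "mean field_energy \<le> (n / d) / (1 - \<beta>)"
proof -
  let ?t = "\<lambda>\<tau> i. tanh (\<beta> * m \<tau> i)"
  let ?b = "\<lambda>\<tau> i. (\<Sum>j\<in>V. J i j * m \<tau> j)"
  \<comment> \<open>\<open>?b \<tau> i\<close> contains \<open>\<tau> i\<close> with coefficient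
    \<open>(J\<^sup>2) i i = 1 / d\<close>; subtracting this part makes \<open>?g\<close> invariant
    under the flip at \<open>i\<close>.\<close>
  let ?g = "\<lambda>\<tau> i. ?b \<tau> i - \<tau> i / d"
  have g_flip: "?g (flip i \<tau>) i = ?g \<tau> i" if i: "i \<in> V" for i \<tau>
  proof -
    have "?b (flip i \<tau>) i = ?b \<tau> i - 2 * \<tau> i * (\<Sum>j\<in>V. J i j * J i j)"
      using i by (simp add: field_flip algebra_simps sum_subtractf sum_distrib_left coupling_sym)
    then show ?thesis using sum_coupling_sq[OF i] by simp
  qed
  have swap: "mean (\<lambda>\<tau>. \<tau> i * ?g \<tau> i) \<le> mean (\<lambda>\<tau>. ?t \<tau> i * ?b \<tau> i)" if i: "i \<in> V" for i
  proof -
    have "mean (\<lambda>\<tau>. (\<tau> i - ?t \<tau> i) * ?g \<tau> i) = 0"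
      by (rule conditional_mean[OF i]) (rule g_flip[OF i])
    then have 1: "mean (\<lambda>\<tau>. \<tau> i * ?g \<tau> i) = mean (\<lambda>\<tau>. ?t \<tau> i * ?g \<tau> i)"
      by (simp add: left_diff_distrib mean_diff)
    \<comment> \<open>The correction by \<open>\<tau> i / d\<close> leaves the mean of a square,
      entering with a negative sign, so it can be discarded in an upper bound.\<close>
    have "mean (\<lambda>\<tau>. (\<tau> i - ?t \<tau> i) * ?t \<tau> i) = 0"
      by (rule conditional_mean[OF i]) (simp add: i)
    also have "(\<lambda>\<tau>. (\<tau> i - ?t \<tau> i) * ?t \<tau> i) = (\<lambda>\<tau>. ?t \<tau> i * \<tau> i - (?t \<tau> i)\<^sup>2)"
      by (rule ext) (simp add: algebra_simps power2_eq_square)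
    finally have "mean (\<lambda>\<tau>. ?t \<tau> i * \<tau> i) = mean (\<lambda>\<tau>. (?t \<tau> i)\<^sup>2)"
      unfolding mean_diff by linarith
    also have "\<dots> \<ge> mean (\<lambda>_. 0)" by (rule mean_mono) simp
    finally have 2: "mean (\<lambda>\<tau>. ?t \<tau> i * \<tau> i) \<ge> 0" by (simp add: mean_const)
    have "mean (\<lambda>\<tau>. ?t \<tau> i * ?g \<tau> i) = mean (\<lambda>\<tau>. ?t \<tau> i * ?b \<tau> i - (1 / d) * (?t \<tau> i * \<tau> i))"
      by (rule mean_cong) (simp add: algebra_simps)
    also have "\<dots> = mean (\<lambda>\<tau>. ?t \<tau> i * ?b \<tau> i) - (1 / d) * mean (\<lambda>\<tau>. ?t \<tau> i * \<tau> i)"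
      by (simp only: mean_diff mean_cmult)
    finally show ?thesis using 1 2 by simp
  qed
  have "mean field_energy = mean (\<lambda>\<tau>. n / d + (\<Sum>i\<in>V. \<tau> i * ?g \<tau> i))"
  proof (rule mean_cong)
    fix \<tau> assume \<tau>: "\<tau> \<in> W"
    have "field_energy \<tau> = (\<Sum>i\<in>V. m \<tau> i * (\<Sum>j\<in>V. J i j * \<tau> j))"
      by (simp add: field_energy_def power2_eq_square local_field_def)
    also have "\<dots> = (\<Sum>i\<in>V. \<tau> i * ?b \<tau> i)"
      by (rule sum_coupling_swap)
    also have "\<dots> = (\<Sum>i\<in>V. \<tau> i * ?g \<tau> i + \<tau> i * \<tau> i / d)"
      by (intro sum.cong) (auto simp: algebra_simps)
    also have "\<dots> = (\<Sum>i\<in>V. \<tau> i * ?g \<tau> i + 1 / d)"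
      using spins_sq[OF \<tau>] by (intro sum.cong) auto
    finally show "field_energy \<tau> = n / d + (\<Sum>i\<in>V. \<tau> i * ?g \<tau> i)"
      by (simp add: sum.distrib)
  qed
  also have "\<dots> = n / d + (\<Sum>i\<in>V. mean (\<lambda>\<tau>. \<tau> i * ?g \<tau> i))"
    by (simp only: mean_add mean_const mean_sum)
  also have "\<dots> \<le> n / d + (\<Sum>i\<in>V. mean (\<lambda>\<tau>. ?t \<tau> i * ?b \<tau> i))"
    using swap by (intro add_left_mono sum_mono)
  also have "\<dots> = n / d + mean (\<lambda>\<tau>. \<Sum>i\<in>V. ?t \<tau> i * ?b \<tau> i)"
    by (simp only: mean_sum)
  also have "mean (\<lambda>\<tau>. \<Sum>i\<in>V. ?t \<tau> i * ?b \<tau> i) \<le> mean (\<lambda>\<tau>. \<beta> * field_energy \<tau>)"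
  proof (rule mean_mono)
    fix \<tau>
    have "(\<Sum>i\<in>V. ?t \<tau> i * ?b \<tau> i) \<le> (\<Sum>i\<in>V. \<beta> * (\<bar>m \<tau> i\<bar> * (\<Sum>j\<in>V. J i j * \<bar>m \<tau> j\<bar>)))"
    proof (rule sum_mono)
      fix i
      have t: "\<bar>?t \<tau> i\<bar> \<le> \<beta> * \<bar>m \<tau> i\<bar>"
        using abs_tanh_real_le[of "\<beta> * m \<tau> i"] \<beta>_nonneg by (simp add: abs_mult)
      have b: "\<bar>?b \<tau> i\<bar> \<le> (\<Sum>j\<in>V. J i j * \<bar>m \<tau> j\<bar>)"
        by (rule order_trans[OF sum_abs]) (simp add: abs_mult coupling_nonneg)
      have "?t \<tau> i * ?b \<tau> i \<le> \<bar>?t \<tau> i\<bar> * \<bar>?b \<tau> i\<bar>"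
        by (metis abs_ge_self abs_mult)
      also have "\<dots> \<le> (\<beta> * \<bar>m \<tau> i\<bar>) * (\<Sum>j\<in>V. J i j * \<bar>m \<tau> j\<bar>)"
        using t b \<beta>_nonneg by (intro mult_mono) auto
      finally show "?t \<tau> i * ?b \<tau> i \<le> \<beta> * (\<bar>m \<tau> i\<bar> * (\<Sum>j\<in>V. J i j * \<bar>m \<tau> j\<bar>))"
        by simp
    qed
    also have "\<dots> \<le> \<beta> * field_energy \<tau>"
      using coupling_form_le[of "\<lambda>i. \<bar>m \<tau> i\<bar>" "\<lambda>i. \<bar>m \<tau> i\<bar>"] \<beta>_nonneg
      unfolding sum_distrib_left[symmetric] by (intro mult_left_mono) (auto simp: field_energy_def)
    finally show "(\<Sum>i\<in>V. ?t \<tau> i * ?b \<tau> i) \<le> \<beta> * field_energy \<tau>" .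
  qed
  also have "mean (\<lambda>\<tau>. \<beta> * field_energy \<tau>) = \<beta> * mean field_energy"
    by (rule mean_cmult)
  finally have "(1 - \<beta>) * mean field_energy \<le> n / d"
    by (simp add: algebra_simps)
  then show ?thesis using assms by (subst pos_le_divide_eq) (auto simp: mult.commute)
qed

end

section \<open>Lower bounds for the partition function\<close>

lemma cosh_real_lower: "1 + x\<^sup>2 / 4 \<le> cosh x" if "0 \<le> x" for x :: real
proof -
  have "1 + x + x\<^sup>2 / 2 \<le> exp x"
    using exp_lower_Taylor_quadratic[OF that] .
  moreover have "1 - x \<le> exp (- x)"
    using exp_ge_add_one_self[of "- x"] by simp
  ultimately show ?thesis by (simp add: cosh_def)
qed

text \<open>The sum factorises over the vertices into factors \<open>(-1) ^ k v + 1\<close>, each 0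
  or 2. This positivity is the mechanism of the first Griffiths inequality.\<close>

lemma sum_monomial_nonneg:
  fixes k :: "'v \<Rightarrow> nat"
  assumes "finite (pverts G)"
  shows "0 \<le> (\<Sum>\<tau>\<in>spins G. \<Prod>v\<in>pverts G. \<tau> v ^ k v)"
proof -
  have "0 \<le> (-1) ^ k v + (1::real) ^ k v" for v
    by (cases "even (k v)") auto
  then show ?thesis
    by (subst sum_spins_prod[OF assms]) (rule prod_nonneg, auto)
qed

lemma monomial_mult:
  fixes k :: "'v \<Rightarrow> nat" and \<tau> :: "'v \<Rightarrow> real"
  assumes "finite V" "i \<in> V"
  shows "\<tau> i * (\<Prod>v\<in>V. \<tau> v ^ k v) = (\<Prod>v\<in>V. \<tau> v ^ (k(i := Suc (k i))) v)"
  using assms by (simp add: prod.remove[of V i] mult_ac)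

text \<open>The extra monomial carries the induction: expanding one arc factor either leaves the
  exponents \<open>k\<close> alone or raises those of its two ends.\<close>

lemma sum_arc_product_nonneg:
  fixes k :: "'v \<Rightarrow> nat"
  assumes "finite (pverts G)" "B \<subseteq> pverts G \<times> pverts G" "0 \<le> c" "0 \<le> s"
  shows "0 \<le> (\<Sum>\<tau>\<in>spins G. (\<Prod>(i, j)\<in>B. c + s * (\<tau> i * \<tau> j)) * (\<Prod>v\<in>pverts G. \<tau> v ^ k v))"
proof -
  have "finite B" using assms(1,2) finite_subset by blast
  then show ?thesis using assms(2)
  proof (induction B arbitrary: k)
    case empty
    then show ?case using sum_monomial_nonneg[OF assms(1)] by simp
  next
    case (insert e B)
    obtain i j where e: "e = (i, j)" by (cases e)
    have ij: "i \<in> pverts G" "j \<in> pverts G" using insert.prems e by auto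
    let ?X = "\<lambda>\<tau>. \<Prod>(i, j)\<in>B. c + s * (\<tau> i * \<tau> j)"
    let ?M = "\<lambda>k \<tau>. \<Prod>v\<in>pverts G. \<tau> v ^ (k v :: nat) :: real"
    \<comment> \<open>Raising the exponents one after the other also covers the case
      \<open>i = j\<close>.\<close>
    define k1 where "k1 = k(j := Suc (k j))"
    define k2 where "k2 = k1(i := Suc (k1 i))"
    have M: "\<tau> i * (\<tau> j * ?M k \<tau>) = ?M k2 \<tau>" for \<tau>
      unfolding k2_def k1_def using ij by (simp only: monomial_mult[OF assms(1)])
    have "(\<Sum>\<tau>\<in>spins G. (\<Prod>(i, j)\<in>insert e B. c + s * (\<tau> i * \<tau> j)) * ?M k \<tau>)
        = (\<Sum>\<tau>\<in>spins G. c * (?X \<tau> * ?M k \<tau>) + s * (?X \<tau> * ?M k2 \<tau>))"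
      using insert.hyps by (intro sum.cong) (simp_all add: e M[symmetric] algebra_simps)
    also have "\<dots> = c * (\<Sum>\<tau>\<in>spins G. ?X \<tau> * ?M k \<tau>) + s * (\<Sum>\<tau>\<in>spins G. ?X \<tau> * ?M k2 \<tau>)"
      by (simp only: sum.distrib sum_distrib_left)
    also have "\<dots> \<ge> 0"
      using insert.IH insert.prems assms(3,4) by (intro add_nonneg_nonneg mult_nonneg_nonneg) auto
    finally show ?case .
  qed
qed

text \<open>Of the expansion over the arcs only the term with no arc selected is kept; the others
  are nonnegative by \<open>sum_arc_product_nonneg\<close>.\<close>

lemma sum_arc_product_lower:
  assumes "finite (pverts G)" "B \<subseteq> pverts G \<times> pverts G" "0 \<le> c" "0 \<le> s"
  shows "c ^ card B * 2 ^ card (pverts G) \<le> (\<Sum>\<tau>\<in>spins G. \<Prod>(i, j)\<in>B. c + s * (\<tau> i * \<tau> j))"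
proof -
  have "finite B" using assms(1,2) finite_subset by blast
  then show ?thesis using assms(2)
  proof (induction B)
    case empty
    then show ?case using card_spins[OF assms(1)] by simp
  next
    case (insert e B)
    obtain i j where e: "e = (i, j)" by (cases e)
    have ij: "i \<in> pverts G" "j \<in> pverts G" using insert.prems e by auto
    let ?X = "\<lambda>\<tau>. \<Prod>(i, j)\<in>B. c + s * (\<tau> i * \<tau> j)"
    define k where "k = (\<lambda>v. 0 :: nat)(j := Suc 0)"
    define k2 where "k2 = k(i := Suc (k i))"
    have M: "\<tau> i * \<tau> j = (\<Prod>v\<in>pverts G. \<tau> v ^ k2 v)" for \<tau> :: "'a \<Rightarrow> real"
      using monomial_mult[OF assms(1) ij(1), of \<tau> k] monomial_mult[OF assms(1) ij(2), of \<tau> "\<lambda>_. 0"]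
      by (simp add: k2_def k_def)
    have "c ^ card (insert e B) * 2 ^ card (pverts G) \<le> c * (\<Sum>\<tau>\<in>spins G. ?X \<tau>)"
      using insert assms(3) by (simp add: mult_left_mono mult.assoc)
    also have "\<dots> \<le> c * (\<Sum>\<tau>\<in>spins G. ?X \<tau>) + s * (\<Sum>\<tau>\<in>spins G. ?X \<tau> * (\<Prod>v\<in>pverts G. \<tau> v ^ k2 v))"
      using sum_arc_product_nonneg[OF assms(1) _ assms(3,4), of B k2] insert.prems assms(4) by simp
    also have "\<dots> = (\<Sum>\<tau>\<in>spins G. \<Prod>(i, j)\<in>insert e B. c + s * (\<tau> i * \<tau> j))"
      using insert.hyps
      by (simp add: e M[symmetric] sum_distrib_left sum.distrib[symmetric] algebra_simps)
    finally show ?case .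
  qed
qed

text \<open>The relative entropy per spin of the product measure with magnetisation \<open>t\<close>.\<close>
definition spin_entropy :: "real \<Rightarrow> real" where
  "spin_entropy t = ((1 + t) * ln (1 + t) + (1 - t) * ln (1 - t)) / 2"

text \<open>Near 0 the entropy cost is \<open>t\<^sup>2 / 2\<close> to leading order, against an
  energy gain of \<open>\<beta> * t\<^sup>2 / 2\<close>. For \<beta> > 1 the energy wins at some
  small magnetisation.\<close>

lemma spin_entropy_small:
  assumes "\<beta> > 1"
  obtains t where "0 < t" "t < 1" "spin_entropy t < \<beta> * t\<^sup>2 / 2"
proof -
  have "((\<lambda>t. spin_entropy t / t\<^sup>2) \<longlongrightarrow> 1 / 2) (at_right 0)"
    unfolding spin_entropy_def by real_asymp
  then have "eventually (\<lambda>t. spin_entropy t / t\<^sup>2 < \<beta> / 2) (at_right 0)"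
    using assms by (intro order_tendstoD) auto
  moreover have "eventually (\<lambda>t. t \<in> {0<..<1::real}) (at_right 0)"
    by (rule eventually_at_right_real) simp
  ultimately have "eventually (\<lambda>t. 0 < t \<and> t < 1 \<and> spin_entropy t < \<beta> * t\<^sup>2 / 2) (at_right 0)"
    by eventually_elim (auto simp: field_simps)
  then show ?thesis
    using that eventually_happens[of _ "at_right (0::real)"] trivial_limit_at_right_real by blast
qed

section \<open>Bounds for the log-partition function and their consequences\<close>

context regular_ising
begin

abbreviation "F \<equiv> log_partition G d \<beta>"

lemma partition_pos: "0 < (\<Sum>\<tau>\<in>W. exp (1 / 2 * \<beta> * H \<tau>))"
  using finite_W spins_nonempty by (intro sum_pos) auto

lemma exp_log_partition: "exp F = (\<Sum>\<tau>\<in>W. exp (1 / 2 * \<beta> * H \<tau>)) / 2 ^ card V"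
  using partition_pos by (simp add: log_partition_def)

lemma arcs_subset: "parcs G \<subseteq> V \<times> V"
  using arc_verts by auto

lemma finite_arcs: "finite (parcs G)"
  using arcs_subset finite_subset by blast

lemma suff_stat_arcs: "H \<tau> = (\<Sum>(i, j)\<in>parcs G. \<tau> i * \<tau> j) / d"
proof -
  have "H \<tau> = (\<Sum>(i, j)\<in>V \<times> V. \<tau> i * J i j * \<tau> j)"
    by (simp add: suff_stat_def sum.cartesian_product)
  also have "\<dots> = (\<Sum>(i, j)\<in>parcs G. \<tau> i * \<tau> j / d)"
    using arcs_subset
    by (intro sum.mono_neutral_cong_right) (auto simp: coupling_def adjacency_def)
  finally show ?thesis by (simp add: sum_divide_distrib case_prod_unfold)
qed

lemma card_arcs: "real (card (parcs G)) = n * d"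
proof -
  have "real (card (parcs G)) = (\<Sum>(i, j)\<in>parcs G. 1)" by simp
  also have "\<dots> = (\<Sum>(i, j)\<in>V \<times> V. adjacency G i j)"
    using arcs_subset by (intro sum.mono_neutral_cong_left) (auto simp: adjacency_def)
  also have "\<dots> = (\<Sum>i\<in>V. \<Sum>j\<in>V. adjacency G i j)"
    by (simp add: sum.cartesian_product)
  finally show ?thesis by (simp add: sum_adjacency)
qed

text \<open>High-temperature expansion: each of the \<open>n * d\<close> arcs carries the exponent
  \<open>b * s\<close> with \<open>b = \<beta> / (2 * d)\<close> and a sign \<open>s\<close>, and
  \<open>exp (b * s) = cosh b + s * sinh b\<close>.\<close>

lemma log_partition_ge_cosh: "F \<ge> n * d * ln (cosh (\<beta> / (2 * d)))"
proof -
  define b where "b = \<beta> / (2 * d)"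
  have b: "0 \<le> b" using \<beta>_nonneg by (simp add: b_def)
  have factor: "exp (1 / 2 * \<beta> * H \<tau>) = (\<Prod>(i, j)\<in>parcs G. cosh b + sinh b * (\<tau> i * \<tau> j))" if \<tau>: "\<tau> \<in> W" for \<tau>
  proof -
    have "1 / 2 * \<beta> * H \<tau> = (\<Sum>e\<in>parcs G. b * (\<tau> (fst e) * \<tau> (snd e)))"
      by (simp add: suff_stat_arcs b_def sum_distrib_left case_prod_unfold sum_divide_distrib)
    then have "exp (1 / 2 * \<beta> * H \<tau>) = (\<Prod>e\<in>parcs G. exp (b * (\<tau> (fst e) * \<tau> (snd e))))"
      using finite_arcs by (simp add: exp_sum)
    also have "\<dots> = (\<Prod>(i, j)\<in>parcs G. cosh b + sinh b * (\<tau> i * \<tau> j))"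
    proof (rule prod.cong[OF refl], clarsimp)
      fix i j assume "(i, j) \<in> parcs G"
      then show "exp (b * (\<tau> i * \<tau> j)) = cosh b + sinh b * (\<tau> i * \<tau> j)"
        using spins_cases[OF \<tau>, of i] spins_cases[OF \<tau>, of j] arc_verts
        by (auto simp: cosh_plus_sinh cosh_minus_sinh)
    qed
    finally show ?thesis .
  qed
  have "cosh b ^ card (parcs G) * 2 ^ card V \<le> (\<Sum>\<tau>\<in>W. exp (1 / 2 * \<beta> * H \<tau>))"
    using sum_arc_product_lower[OF finite_V arcs_subset, of "cosh b" "sinh b"] b factor
    by (simp add: cosh_real_nonneg)
  then have "cosh b ^ card (parcs G) \<le> exp F"
    by (simp add: exp_log_partition pos_le_divide_eq)
  then have "ln (cosh b ^ card (parcs G)) \<le> F"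
    using cosh_real_pos[of b] by (metis ln_exp ln_le_cancel_iff exp_gt_zero zero_less_power)
  then show ?thesis
    using cosh_real_pos[of b] by (simp add: ln_realpow card_arcs b_def)
qed

lemma log_partition_nonneg: "0 \<le> F"
  by (rule order_trans[OF _ log_partition_ge_cosh]) (simp add: cosh_real_ge_1)

text \<open>With \<open>b\<close> of order \<open>1 / d\<close>, \<open>ln (cosh b)\<close> is at
  least \<open>b\<^sup>2 / 8\<close>, so the \<open>n * d\<close> arcs together contribute the order
  \<open>n / d\<close>.\<close>

lemma log_partition_ge_high_temperature:
  assumes "\<beta> < 1"
  shows "F \<ge> \<beta>\<^sup>2 / 32 * (n / d)"
proof -
  define b where "b = \<beta> / (2 * d)"
  have b: "0 \<le> b" "b \<le> 1"
    using \<beta>_nonneg assms d_pos by (simp_all add: b_def field_simps)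
  have sq: "b\<^sup>2 \<le> 1" using b by (simp add: power_le_one)
  have y: "(b\<^sup>2 / 4)\<^sup>2 \<le> (b\<^sup>2 / 4) * (1 / 2)"
    unfolding power2_eq_square[of "b\<^sup>2 / 4"] using sq by (intro mult_left_mono) auto
  have "b\<^sup>2 / 8 \<le> b\<^sup>2 / 4 - (b\<^sup>2 / 4)\<^sup>2" using y by simp
  also have "\<dots> \<le> ln (1 + b\<^sup>2 / 4)"
    using sq by (intro ln_one_plus_pos_lower_bound) auto
  also have "\<dots> \<le> ln (cosh b)"
    using cosh_real_lower[OF b(1)] by (subst ln_le_cancel_iff) (auto simp: add_pos_nonneg cosh_real_pos)
  finally have "n * d * (b\<^sup>2 / 8) \<le> n * d * ln (cosh b)"
    by (intro mult_left_mono) auto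
  also have "\<dots> \<le> F" unfolding b_def by (rule log_partition_ge_cosh)
  also have "n * d * (b\<^sup>2 / 8) = \<beta>\<^sup>2 / 32 * (n / d)"
    using d_pos by (simp add: b_def power2_eq_square field_simps)
  finally show ?thesis .
qed

text \<open>The Gibbs variational principle, with the product measure \<open>\<mu>\<close> of
  magnetisation \<open>t\<close> as trial measure: mean energy minus relative entropy to fair spins.
  Independence and unit row sums give the same mean energy on every regular graph.\<close>

lemma log_partition_ge_tilt:
  assumes t: "0 < t" "t < 1"
  shows "F \<ge> n * (\<beta> * t\<^sup>2 / 2 - spin_entropy t)"
proof -
  define \<mu> where "\<mu> = (\<lambda>\<tau>. \<Prod>i\<in>V. (1 + t * \<tau> i) / 2)"
  \<comment> \<open>On the two points -1 and 1 the function \<open>ln (1 + t * x)\<close> of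
    \<open>x\<close> is affine, with intercept \<open>A\<close> and slope \<open>B\<close>.\<close>
  define A where "A = (ln (1 + t) + ln (1 - t)) / 2"
  define B where "B = (ln (1 + t) - ln (1 - t)) / 2"
  define y where "y = n * (\<beta> * t\<^sup>2 / 2 - spin_entropy t)"
  \<comment> \<open>The logarithm of the density, with respect to \<open>\<mu>\<close>, of the Gibbs
    weight relative to fair spins.\<close>
  define X where "X = (\<lambda>\<tau>. 1 / 2 * \<beta> * H \<tau> - (\<Sum>i\<in>V. A + B * \<tau> i))"
  have pos: "0 < 1 + t * \<tau> i" if "\<tau> \<in> W" "i \<in> V" for \<tau> i
    using spins_cases[OF that] t by auto
  have \<mu>_pos: "0 < \<mu> \<tau>" if "\<tau> \<in> W" for \<tau>
    unfolding \<mu>_def using pos[OF that] by (intro prod_pos) auto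
  have weight: "exp (1 / 2 * \<beta> * H \<tau>) / 2 ^ card V = \<mu> \<tau> * exp (X \<tau>)" if \<tau>: "\<tau> \<in> W" for \<tau>
  proof -
    have "exp (\<Sum>i\<in>V. A + B * \<tau> i) = (\<Prod>i\<in>V. 1 + t * \<tau> i)"
      unfolding exp_sum[OF finite_V]
    proof (rule prod.cong[OF refl])
      fix i assume i: "i \<in> V"
      have "A + B * \<tau> i = ln (1 + t * \<tau> i)"
        using spins_cases[OF \<tau> i] by (auto simp: A_def B_def field_simps)
      then show "exp (A + B * \<tau> i) = 1 + t * \<tau> i" using pos[OF \<tau> i] by simp
    qed
    moreover have "1 + t * \<tau> i \<noteq> 0" if "i \<in> V" for i
      using pos[OF \<tau> that] by simp
    ultimately show ?thesis
      by (simp add: \<mu>_def X_def exp_diff prod_dividef)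
  qed
  have total: "(\<Sum>\<tau>\<in>W. \<mu> \<tau>) = 1"
    unfolding \<mu>_def by (subst sum_spins_prod[OF finite_V, where f = "\<lambda>i x. (1 + t * x) / 2"]) (simp add: field_simps)
  \<comment> \<open>Under \<open>\<mu>\<close> spin \<open>i\<close> has mean \<open>t\<close>
    independently of the others; the flip argument is the one used for the Ising measure.\<close>
  have \<mu>_odd: "(\<Sum>\<tau>\<in>W. \<mu> \<tau> * ((\<tau> i - t) * g \<tau>)) = 0"
    if i: "i \<in> V" and g: "\<And>\<tau>. \<tau> \<in> W \<Longrightarrow> g (flip i \<tau>) = g \<tau>" for i g
  proof (rule sum_spins_odd[OF i])
    fix \<tau> assume \<tau>: "\<tau> \<in> W"
    define R where "R = (\<Prod>j\<in>V - {i}. (1 + t * \<tau> j) / 2)"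
    have 1: "\<mu> \<tau> = (1 + t * \<tau> i) / 2 * R"
      unfolding \<mu>_def R_def by (rule prod.remove[OF finite_V i])
    have 2: "\<mu> (flip i \<tau>) = (1 - t * \<tau> i) / 2 * R"
      unfolding \<mu>_def R_def by (subst prod.remove[OF finite_V i]) (auto intro!: arg_cong2[of _ _ _ _ times] prod.cong)
    show "\<mu> (flip i \<tau>) * ((flip i \<tau> i - t) * g (flip i \<tau>)) = - (\<mu> \<tau> * ((\<tau> i - t) * g \<tau>))"
      unfolding 1 2 g[OF \<tau>] flip_same using spins_cases[OF \<tau> i] by (auto simp: field_simps)
  qed
  have first: "(\<Sum>\<tau>\<in>W. \<mu> \<tau> * \<tau> i) = t" if i: "i \<in> V" for i
    using \<mu>_odd[OF i, of "\<lambda>_. 1"] total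
    by (simp add: algebra_simps sum_subtractf sum_distrib_left[symmetric])
  have second: "(\<Sum>\<tau>\<in>W. \<mu> \<tau> * (\<tau> i * \<tau> j)) = t\<^sup>2" if i: "i \<in> V" and j: "j \<in> V" and "i \<noteq> j" for i j
  proof -
    have "(\<Sum>\<tau>\<in>W. \<mu> \<tau> * ((\<tau> i - t) * \<tau> j)) = 0"
      by (rule \<mu>_odd[OF i]) (use \<open>i \<noteq> j\<close> in auto)
    moreover have "(\<Sum>\<tau>\<in>W. \<mu> \<tau> * ((\<tau> i - t) * \<tau> j)) = (\<Sum>\<tau>\<in>W. \<mu> \<tau> * (\<tau> i * \<tau> j)) - t * (\<Sum>\<tau>\<in>W. \<mu> \<tau> * \<tau> j)"
      by (simp add: sum_distrib_left sum_subtractf[symmetric] algebra_simps)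
    ultimately show ?thesis using first[OF j] by (simp add: power2_eq_square)
  qed
  have "(\<Sum>\<tau>\<in>W. \<mu> \<tau> * H \<tau>) = (\<Sum>i\<in>V. \<Sum>j\<in>V. J i j * (\<Sum>\<tau>\<in>W. \<mu> \<tau> * (\<tau> i * \<tau> j)))"
    unfolding suff_stat_def sum_distrib_left
    by (subst sum.swap, intro sum.cong refl, subst sum.swap) (auto intro!: sum.cong)
  \<comment> \<open>The diagonal, where the second moment is 1 and not \<open>t\<^sup>2\<close>,
    drops out because \<open>J i i = 0\<close>.\<close>
  also have "\<dots> = (\<Sum>i\<in>V. \<Sum>j\<in>V. J i j * t\<^sup>2)"
  proof (intro sum.cong refl)
    fix i j assume "i \<in> V" "j \<in> V"
    then show "J i j * (\<Sum>\<tau>\<in>W. \<mu> \<tau> * (\<tau> i * \<tau> j)) = J i j * t\<^sup>2"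
      using second[of i j] by (cases "i = j") auto
  qed
  also have "\<dots> = n * t\<^sup>2"
    by (simp add: sum_distrib_right[symmetric] sum_coupling)
  finally have meanH: "(\<Sum>\<tau>\<in>W. \<mu> \<tau> * H \<tau>) = n * t\<^sup>2" .
  have "(\<Sum>\<tau>\<in>W. \<mu> \<tau> * (\<Sum>i\<in>V. A + B * \<tau> i)) = (\<Sum>i\<in>V. A * (\<Sum>\<tau>\<in>W. \<mu> \<tau>) + B * (\<Sum>\<tau>\<in>W. \<mu> \<tau> * \<tau> i))"
    unfolding sum_distrib_left sum.distrib[symmetric]
    by (subst sum.swap) (auto intro!: sum.cong simp: algebra_simps)
  also have "\<dots> = n * (A + B * t)"
    using first total by simp
  also have "A + B * t = spin_entropy t"
    by (simp add: A_def B_def spin_entropy_def field_simps)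
  finally have mean_ln: "(\<Sum>\<tau>\<in>W. \<mu> \<tau> * (\<Sum>i\<in>V. A + B * \<tau> i)) = n * spin_entropy t" .
  have "(\<Sum>\<tau>\<in>W. \<mu> \<tau> * X \<tau>) = 1 / 2 * \<beta> * (\<Sum>\<tau>\<in>W. \<mu> \<tau> * H \<tau>) - (\<Sum>\<tau>\<in>W. \<mu> \<tau> * (\<Sum>i\<in>V. A + B * \<tau> i))"
    unfolding X_def right_diff_distrib sum_subtractf by (simp add: sum_distrib_left mult_ac)
  then have meanX: "(\<Sum>\<tau>\<in>W. \<mu> \<tau> * X \<tau>) = y"
    unfolding meanH mean_ln by (simp add: y_def algebra_simps)
  \<comment> \<open>Jensen's inequality, by means of the tangent of \<open>exp\<close> at the mean
    \<open>y\<close> of \<open>X\<close>.\<close>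
  have "exp y = (\<Sum>\<tau>\<in>W. \<mu> \<tau> * (exp y * (1 + (X \<tau> - y))))"
  proof -
    have "(\<Sum>\<tau>\<in>W. \<mu> \<tau> * (exp y * (1 + (X \<tau> - y))))
        = exp y * ((1 - y) * (\<Sum>\<tau>\<in>W. \<mu> \<tau>) + (\<Sum>\<tau>\<in>W. \<mu> \<tau> * X \<tau>))"
      unfolding sum_distrib_left sum.distrib[symmetric] by (intro sum.cong) (auto simp: algebra_simps)
    then show ?thesis by (simp add: total meanX)
  qed
  also have "\<dots> \<le> (\<Sum>\<tau>\<in>W. \<mu> \<tau> * exp (X \<tau>))"
  proof (intro sum_mono mult_left_mono)
    fix \<tau> assume "\<tau> \<in> W"
    show "exp y * (1 + (X \<tau> - y)) \<le> exp (X \<tau>)"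
      using mult_left_mono[OF exp_ge_add_one_self[of "X \<tau> - y"], of "exp y"]
      by (simp add: exp_add[symmetric])
    show "0 \<le> \<mu> \<tau>" using \<mu>_pos[OF \<open>\<tau> \<in> W\<close>] by simp
  qed
  also have "\<dots> = exp F"
    unfolding exp_log_partition sum_divide_distrib using weight by (intro sum.cong) auto
  finally show ?thesis by (simp add: y_def)
qed

text \<open>Each configuration with \<open>H \<tau> < s\<close> has mass at most
  \<open>exp (\<beta> * s / 2 - F) / 2 ^ card V\<close>, and there are \<open>2 ^ card V\<close>
  configurations in all. A large \<open>F\<close> thus makes small values of \<open>H\<close>
  unlikely.\<close>

lemma prob_suff_stat_less: "mean (indicator {\<tau>. H \<tau> < s}) \<le> exp (\<beta> * s / 2 - F)"
proof -
  have "mean (indicator {\<tau>. H \<tau> < s}) \<le> (\<Sum>\<tau>\<in>W. 1 / 2 ^ card V * exp (\<beta> * s / 2 - F))"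
    unfolding mean_def
  proof (rule sum_mono)
    fix \<tau>
    have "exp (1 / 2 * \<beta> * H \<tau> - F) \<le> exp (\<beta> * s / 2 - F)" if "H \<tau> < s"
      using that mult_left_mono[of "H \<tau>" s \<beta>] \<beta>_nonneg by simp
    then show "ising_mass G d \<beta> \<tau> * indicator {\<tau>. H \<tau> < s} \<tau> \<le> 1 / 2 ^ card V * exp (\<beta> * s / 2 - F)"
      by (auto simp: indicator_def ising_mass_def divide_right_mono)
  qed
  also have "\<dots> = exp (\<beta> * s / 2 - F)"
    by (simp add: card_spins)
  finally show ?thesis .
qed

text \<open>Where \<open>H \<tau> < s\<close>, the density with respect to fair spins is at most
  \<open>exp (\<beta> * s / 2)\<close>, since \<open>F\<close> is nonnegative. The complementary
  event is left to Markov's inequality.\<close>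

lemma prob_le_uniform:
  assumes "0 < s"
  shows "mean (indicator A) \<le> mean (\<lambda>\<tau>. \<bar>H \<tau>\<bar>) / s + exp (\<beta> * s / 2) * (real (card (A \<inter> W)) / 2 ^ card V)"
proof -
  have "mean (indicator A) \<le> (\<Sum>\<tau>\<in>W. ising_mass G d \<beta> \<tau> * (1 / s * \<bar>H \<tau>\<bar>) + exp (\<beta> * s / 2) / 2 ^ card V * indicator A \<tau>)"
    unfolding mean_def
  proof (rule sum_mono)
    fix \<tau>
    show "ising_mass G d \<beta> \<tau> * indicator A \<tau>
        \<le> ising_mass G d \<beta> \<tau> * (1 / s * \<bar>H \<tau>\<bar>) + exp (\<beta> * s / 2) / 2 ^ card V * indicator A \<tau>"
    proof (cases "H \<tau> < s")
      case True
      have "exp (1 / 2 * \<beta> * H \<tau> - F) \<le> exp (\<beta> * s / 2)"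
        using True mult_left_mono[of "H \<tau>" s \<beta>] \<beta>_nonneg log_partition_nonneg by simp
      then have "ising_mass G d \<beta> \<tau> * indicator A \<tau> \<le> exp (\<beta> * s / 2) / 2 ^ card V * indicator A \<tau>"
        by (intro mult_right_mono) (auto simp: ising_mass_def divide_right_mono)
      moreover have "0 \<le> ising_mass G d \<beta> \<tau> * (1 / s * \<bar>H \<tau>\<bar>)"
        using mass_nonneg assms by simp
      ultimately show ?thesis by linarith
    next
      case False
      then have "indicator A \<tau> \<le> 1 / s * \<bar>H \<tau>\<bar>"
        using assms by (auto simp: indicator_def field_simps)
      then have "ising_mass G d \<beta> \<tau> * indicator A \<tau> \<le> ising_mass G d \<beta> \<tau> * (1 / s * \<bar>H \<tau>\<bar>)"
        by (intro mult_left_mono mass_nonneg)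
      moreover have "0 \<le> exp (\<beta> * s / 2) / 2 ^ card V * (indicator A \<tau> :: real)"
        by simp
      ultimately show ?thesis by linarith
    qed
  qed
  also have "\<dots> = 1 / s * mean (\<lambda>\<tau>. \<bar>H \<tau>\<bar>) + exp (\<beta> * s / 2) / 2 ^ card V * (\<Sum>\<tau>\<in>W. indicator A \<tau>)"
    by (simp only: sum.distrib mean_def sum_distrib_left mult.left_commute)
  also have "(\<Sum>\<tau>\<in>W. indicator A \<tau> :: real) = real (card (A \<inter> W))"
    by (simp add: indicator_def of_bool_def sum.If_cases Int_commute Collect_conj_eq)
  finally show ?thesis by simp
qed

end

section \<open>Uniform spins and the location of the estimator\<close>

lemma central_binomial_upper_bound: "real (2 * k choose k) ^ 2 * (2 * k + 1) \<le> 16 ^ k"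
proof (induction k)
  case (Suc k)
  define c where "c = real (2 * k choose k)"
  have rec: "real (Suc k) * real (2 * Suc k choose Suc k) = 2 * (2 * k + 1) * c"
  proof -
    have "Suc k * (2 * Suc k choose Suc k) = 2 * (Suc k * (Suc (2 * k) choose k))"
      using Suc_times_binomial[of k "Suc (2 * k)"] by simp
    also have "Suc k * (Suc (2 * k) choose k) = Suc (2 * k) * (2 * k choose k)"
      using binomial_absorb_comp[of "Suc (2 * k)" k] by simp
    finally have "real (Suc k * (2 * Suc k choose Suc k)) = real (2 * (Suc (2 * k) * (2 * k choose k)))"
      by (rule arg_cong)
    then show ?thesis unfolding c_def of_nat_mult by simp
  qed
  have "real (Suc k) ^ 2 * (real (2 * Suc k choose Suc k) ^ 2 * (2 * Suc k + 1))
      = (real (Suc k) * real (2 * Suc k choose Suc k)) ^ 2 * (2 * Suc k + 1)"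
    by (simp only: power_mult_distrib mult.assoc)
  also have "\<dots> = 4 * (2 * real k + 1) * (2 * real k + 3) * (c ^ 2 * (2 * k + 1))"
    unfolding rec by (simp add: power2_eq_square algebra_simps)
  also have "\<dots> \<le> 4 * (2 * real k + 1) * (2 * real k + 3) * 16 ^ k"
    using Suc.IH unfolding c_def by (intro mult_left_mono) auto
  \<comment> \<open>Here \<open>(2 * k + 1) * (2 * k + 3) \<le> (2 * k + 2)\<^sup>2\<close>; the
    factor \<open>2 * k + 1\<close> in the claim is what closes the induction.\<close>
  also have "\<dots> \<le> (4 * (2 * real (Suc k)) ^ 2) * 16 ^ k"
    by (intro mult_right_mono) (auto simp: power2_eq_square algebra_simps)
  also have "\<dots> = real (Suc k) ^ 2 * 16 ^ Suc k"
    by (simp only: power_mult_distrib) simp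
  finally show ?case
    by (rule mult_left_le_imp_le) simp
qed simp

text \<open>The central coefficient dominates, so only it is estimated. Hence no value of the sum of
  \<open>N\<close> \<ge> 1 fair spins has probability above \<open>1 / sqrt N\<close>.\<close>

lemma binomial_upper_bound: "real (N choose k) * sqrt N \<le> 2 ^ N"
proof -
  have "real (N choose (N div 2)) ^ 2 * N \<le> 4 ^ N"
  proof (cases "even N")
    case True
    then obtain l where l: "N = 2 * l" by blast
    have "real (N choose (N div 2)) ^ 2 * N \<le> real (2 * l choose l) ^ 2 * (2 * l + 1)"
      by (simp add: l mult_left_mono)
    also have "\<dots> \<le> 16 ^ l" by (rule central_binomial_upper_bound)
    finally show ?thesis by (simp add: l power_mult)
  next
    case False
    then obtain l where l: "N = 2 * l + 1" by (auto elim: oddE)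
    \<comment> \<open>An odd \<open>N\<close> is lifted to \<open>N + 1\<close>, whose central
      coefficient is twice that of \<open>N\<close> by Pascal's rule and symmetry.\<close>
    have "2 * Suc l choose Suc l = (Suc (2 * l) choose Suc l) + (Suc (2 * l) choose l)"
      by (simp add: add.commute)
    also have "Suc (2 * l) choose Suc l = Suc (2 * l) choose l"
      by (subst binomial_symmetric) auto
    finally have two: "real (2 * Suc l choose Suc l) = 2 * real (N choose (N div 2))"
      by (simp add: l)
    have "4 * (real (N choose (N div 2)) ^ 2 * N) \<le> real (2 * Suc l choose Suc l) ^ 2 * (2 * Suc l + 1)"
      unfolding two by (simp add: l power_mult_distrib mult_left_mono)
    also have "\<dots> \<le> 16 ^ Suc l" by (rule central_binomial_upper_bound)
    finally have "real (N choose (N div 2)) ^ 2 * N \<le> 4 * 16 ^ l" by (simp add: mult.commute)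
    also have "(4 :: real) * 16 ^ l = 4 ^ N" by (simp add: l power_mult)
    finally show ?thesis .
  qed
  then have "sqrt (real (N choose (N div 2)) ^ 2 * N) \<le> sqrt (4 ^ N)"
    by (rule real_sqrt_le_mono)
  also have "sqrt (4 ^ N) = (2 :: real) ^ N"
    by (simp add: real_sqrt_power)
  finally have "real (N choose (N div 2)) * sqrt N \<le> 2 ^ N"
    by (simp add: real_sqrt_mult)
  moreover have "real (N choose k) * sqrt N \<le> real (N choose (N div 2)) * sqrt N"
    using binomial_maximum[of N k] by (intro mult_right_mono) auto
  ultimately show ?thesis by linarith
qed

text \<open>A sub-Gaussian bound for one fair spin. The estimate
  \<open>exp (- x) \<le> 1 - x + x\<^sup>2\<close> holds because its right side times the quadratic
  Taylor bound of \<open>exp x\<close> is at least 1.\<close>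

lemma cosh_real_upper: "cosh x \<le> exp (x\<^sup>2)" if "0 \<le> x" "x \<le> 1" for x :: real
proof -
  have "exp (- x) \<le> 1 - x + x\<^sup>2"
  proof -
    have "(1 - x + x\<^sup>2) * (1 + x + x\<^sup>2 / 2) = 1 + (x\<^sup>2 + x ^ 3 + x ^ 4) / 2"
      by (simp add: power2_eq_square power3_eq_cube power4_eq_xxxx field_simps)
    then have "1 \<le> (1 - x + x\<^sup>2) * (1 + x + x\<^sup>2 / 2)"
      using that by simp
    also have "\<dots> \<le> (1 - x + x\<^sup>2) * exp x"
      using exp_lower_Taylor_quadratic[OF that(1)] that by (intro mult_left_mono) auto
    finally show ?thesis by (simp add: exp_minus field_simps)
  qed
  then have "cosh x \<le> 1 + x\<^sup>2"
    using exp_bound[OF that] by (simp add: cosh_def)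
  also have "\<dots> \<le> exp (x\<^sup>2)" by simp
  finally show ?thesis .
qed

lemma card_integers_in_interval:
  fixes r c :: real
  assumes "0 \<le> r"
  shows "real (card {k \<in> {..N}. \<bar>2 * real k - c\<bar> < r}) \<le> r + 1"
proof (cases "{k \<in> {..N}. \<bar>2 * real k - c\<bar> < r} = {}")
  case False
  let ?K = "{k \<in> {..N}. \<bar>2 * real k - c\<bar> < r}"
  have fin: "finite ?K" by simp
  have "Min ?K \<in> ?K" "Max ?K \<in> ?K" and le: "Min ?K \<le> Max ?K"
    using False fin Min_in Max_in Max_ge by blast+
  then have "\<bar>2 * real (Min ?K) - c\<bar> < r" "\<bar>2 * real (Max ?K) - c\<bar> < r"
    by blast+
  then have "real (Max ?K) - real (Min ?K) < r" by linarith
  moreover have "?K \<subseteq> {Min ?K..Max ?K}"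
    using fin by (auto intro: Min_le Max_ge)
  then have "card ?K \<le> card {Min ?K..Max ?K}"
    by (intro card_mono) auto
  then have "real (card ?K) \<le> real (Max ?K) - real (Min ?K) + 1"
    using le by simp
  ultimately show ?thesis by linarith
next
  case True
  show ?thesis unfolding True using assms by simp
qed

text \<open>A configuration is determined by its set of plus spins, and the total spin fixes the
  size of that set. At most \<open>r + 1\<close> sizes qualify, and
  \<open>binomial_upper_bound\<close> limits the number of sets of each size.\<close>

lemma card_spins_small_sum:
  assumes fin: "finite (pverts G)" and "pverts G \<noteq> {}" and r: "0 \<le> r"
  shows "real (card {\<tau> \<in> spins G. \<bar>\<Sum>i\<in>pverts G. \<tau> i\<bar> < r})
      \<le> (r + 1) / sqrt (card (pverts G)) * 2 ^ card (pverts G)"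
proof -
  let ?V = "pverts G"
  let ?N = "card ?V"
  let ?L = "{\<tau> \<in> spins G. \<bar>\<Sum>i\<in>?V. \<tau> i\<bar> < r}"
  let ?K = "{k \<in> {..?N}. \<bar>2 * real k - ?N\<bar> < r}"
  define up where "up = (\<lambda>\<tau> :: 'a \<Rightarrow> real. {i \<in> ?V. \<tau> i = 1})"
  have N: "0 < real ?N" using assms by (simp add: card_gt_0_iff)
  have sum_eq: "(\<Sum>i\<in>?V. \<tau> i) = 2 * real (card (up \<tau>)) - ?N" if "\<tau> \<in> spins G" for \<tau>
  proof -
    have "(\<Sum>i\<in>?V. \<tau> i) = (\<Sum>i\<in>?V. 2 * indicator (up \<tau>) i - 1)"
      using spins_cases[OF that] by (intro sum.cong) (auto simp: up_def indicator_def)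
    also have "\<dots> = 2 * real (card (up \<tau>)) - ?N"
      using fin by (simp add: sum_subtractf sum_distrib_left[symmetric] up_def indicator_def of_bool_def sum.If_cases Collect_conj_eq)
    finally show ?thesis .
  qed
  have inj: "inj_on up (spins G)"
  proof (rule inj_onI)
    fix \<sigma> \<tau> assume *: "\<sigma> \<in> spins G" "\<tau> \<in> spins G" "up \<sigma> = up \<tau>"
    have "\<sigma> i = \<tau> i" if "i \<in> ?V" for i
      using spins_cases[OF *(1) that] spins_cases[OF *(2) that] *(3) that
      unfolding up_def set_eq_iff mem_Collect_eq by (metis one_neq_neg_one)
    then show "\<sigma> = \<tau>"
      using *(1,2) unfolding spins_def by (intro PiE_ext) auto
  qed
  have "card ?L = card (up ` ?L)"
    using inj by (intro card_image[symmetric]) (auto elim: inj_on_subset)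
  also have "up ` ?L \<subseteq> (\<Union>k\<in>?K. {A. A \<subseteq> ?V \<and> card A = k})"
    using sum_eq fin by (auto simp: up_def intro: card_mono)
  then have "card (up ` ?L) \<le> card (\<Union>k\<in>?K. {A. A \<subseteq> ?V \<and> card A = k})"
    using fin by (intro card_mono) auto
  also have "\<dots> \<le> (\<Sum>k\<in>?K. card {A. A \<subseteq> ?V \<and> card A = k})"
    by (rule card_UN_le) simp
  also have "\<dots> = (\<Sum>k\<in>?K. ?N choose k)"
    using fin by (simp add: n_subsets)
  finally have "real (card ?L) * sqrt ?N \<le> (\<Sum>k\<in>?K. real (?N choose k)) * sqrt ?N"
    by (intro mult_right_mono) (auto simp flip: of_nat_sum)
  also have "\<dots> \<le> (\<Sum>k\<in>?K. 2 ^ ?N)"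
    unfolding sum_distrib_right by (intro sum_mono binomial_upper_bound)
  also have "\<dots> \<le> (r + 1) * 2 ^ ?N"
    using card_integers_in_interval[OF r, of ?N "real ?N"] by (simp add: mult_right_mono)
  finally show ?thesis using N by (simp add: field_simps)
qed

section \<open>Field energy and maximal field of uniform spins\<close>

context regular_ising
begin

text \<open>Unit column sums make the total field equal to the total spin; the Cauchy-Schwarz
  inequality does the rest.\<close>

lemma field_energy_ge_sum: "(\<Sum>i\<in>V. \<tau> i)\<^sup>2 \<le> n * field_energy \<tau>"
proof -
  have "(\<Sum>i\<in>V. m \<tau> i) = (\<Sum>j\<in>V. \<tau> j * (\<Sum>i\<in>V. J j i))"
    unfolding local_field_def sum_distrib_left
    by (subst sum.swap) (simp add: coupling_sym mult.commute)
  also have "\<dots> = (\<Sum>j\<in>V. \<tau> j)"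
    by (simp add: sum_coupling)
  finally show ?thesis
    using sum_squared_le_sum_of_squares[of "m \<tau>" V] by (simp add: field_energy_def mult.commute)
qed

text \<open>Chernoff's bound for the sum of the \<open>d\<close> fair spins adjacent to
  \<open>i\<close>, applied to both signs.\<close>

lemma card_field_gt:
  assumes i: "i \<in> V" and \<eta>: "0 \<le> \<eta>" "\<eta> \<le> 2"
  shows "real (card {\<tau> \<in> W. \<bar>m \<tau> i\<bar> > \<eta>}) \<le> 2 * exp (- real d * \<eta>\<^sup>2 / 4) * 2 ^ card V"
proof -
  \<comment> \<open>This value minimises the exponent
    \<open>d * \<theta>\<^sup>2 - \<theta> * d * \<eta>\<close>, and \<open>\<eta> \<le> 2\<close>
    brings it into the range of \<open>cosh_real_upper\<close>.\<close>
  define \<theta> where "\<theta> = \<eta> / 2"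
  let ?a = "adjacency G i"
  have dm: "real d * m \<tau> i = (\<Sum>j\<in>V. ?a j * \<tau> j)" for \<tau>
    using d_pos by (simp add: local_field_def coupling_def sum_distrib_left)
  have mgf: "(\<Sum>\<tau>\<in>W. exp (s * (d * m \<tau> i))) \<le> 2 ^ card V * exp (d * \<theta>\<^sup>2)" if s: "s = \<theta> \<or> s = - \<theta>" for s
  proof -
    have "(\<Sum>\<tau>\<in>W. exp (s * (d * m \<tau> i))) = (\<Sum>\<tau>\<in>W. \<Prod>j\<in>V. exp (s * (?a j * \<tau> j)))"
      by (simp add: dm sum_distrib_left exp_sum)
    also have "\<dots> = (\<Prod>j\<in>V. exp (s * (?a j * -1)) + exp (s * (?a j * 1)))"
      by (rule sum_spins_prod[OF finite_V])
    also have "\<dots> = (\<Prod>j\<in>V. 2 * cosh (s * ?a j))"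
      by (intro prod.cong) (simp_all add: cosh_def)
    also have "\<dots> \<le> (\<Prod>j\<in>V. 2 * exp (\<theta>\<^sup>2 * ?a j))"
    proof (rule prod_mono, intro conjI)
      fix j
      show "2 * cosh (s * ?a j) \<le> 2 * exp (\<theta>\<^sup>2 * ?a j)"
        using cosh_real_upper[of \<theta>] \<eta> s by (auto simp: adjacency_def \<theta>_def)
    qed simp
    also have "\<dots> = 2 ^ card V * exp (\<theta>\<^sup>2 * (\<Sum>j\<in>V. ?a j))"
      by (simp add: prod.distrib exp_sum sum_distrib_left)
    also have "\<dots> = 2 ^ card V * exp (d * \<theta>\<^sup>2)"
      by (simp add: sum_adjacency[OF i] mult.commute)
    finally show ?thesis .
  qed
  have "real (card {\<tau> \<in> W. \<bar>m \<tau> i\<bar> > \<eta>}) = (\<Sum>\<tau>\<in>W. of_bool (\<bar>m \<tau> i\<bar> > \<eta>))"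
    by (simp add: of_bool_def sum.If_cases Collect_conj_eq)
  also have "\<dots> \<le> (\<Sum>\<tau>\<in>W. exp (- (\<theta> * d * \<eta>)) * (exp (\<theta> * (d * m \<tau> i)) + exp (- \<theta> * (d * m \<tau> i))))"
  proof (rule sum_mono)
    fix \<tau>
    let ?R = "exp (- (\<theta> * d * \<eta>)) * (exp (\<theta> * (d * m \<tau> i)) + exp (- \<theta> * (d * m \<tau> i)))"
    have R: "?R = exp (\<theta> * d * (m \<tau> i - \<eta>)) + exp (\<theta> * d * (- m \<tau> i - \<eta>))"
      by (simp add: distrib_left exp_add[symmetric] algebra_simps)
    have "1 \<le> ?R" if "\<bar>m \<tau> i\<bar> > \<eta>"
    proof (cases "m \<tau> i > \<eta>")
      case True
      then have "1 \<le> exp (\<theta> * d * (m \<tau> i - \<eta>))" using \<eta> by (simp add: \<theta>_def)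
      then show ?thesis unfolding R by (smt (verit) exp_gt_zero)
    next
      case False
      then have "- m \<tau> i > \<eta>" using that by linarith
      then have "1 \<le> exp (\<theta> * d * (- m \<tau> i - \<eta>))" using \<eta> by (simp add: \<theta>_def)
      then show ?thesis unfolding R by (smt (verit) exp_gt_zero)
    qed
    moreover have "0 \<le> ?R" by simp
    ultimately show "of_bool (\<bar>m \<tau> i\<bar> > \<eta>) \<le> ?R" by auto
  qed
  also have "\<dots> = exp (- (\<theta> * d * \<eta>)) * ((\<Sum>\<tau>\<in>W. exp (\<theta> * (d * m \<tau> i))) + (\<Sum>\<tau>\<in>W. exp (- \<theta> * (d * m \<tau> i))))"
    by (simp only: sum.distrib sum_distrib_left[symmetric])
  also have "\<dots> \<le> exp (- (\<theta> * d * \<eta>)) * (2 ^ card V * exp (d * \<theta>\<^sup>2) + 2 ^ card V * exp (d * \<theta>\<^sup>2))"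
    using mgf[of \<theta>] mgf[of "- \<theta>"] by (intro mult_left_mono add_mono) auto
  also have "\<dots> = 2 * (exp (- (\<theta> * d * \<eta>)) * exp (d * \<theta>\<^sup>2)) * 2 ^ card V"
    by simp
  also have "exp (- (\<theta> * d * \<eta>)) * exp (d * \<theta>\<^sup>2) = exp (- real d * \<eta>\<^sup>2 / 4)"
    by (simp add: exp_add[symmetric] \<theta>_def power2_eq_square field_simps)
  finally show ?thesis .
qed

lemma card_max_field_gt:
  assumes \<eta>: "0 \<le> \<eta>" "\<eta> \<le> 2"
  shows "real (card {\<tau> \<in> W. \<exists>i\<in>V. \<bar>m \<tau> i\<bar> > \<eta>}) \<le> 2 * n * exp (- real d * \<eta>\<^sup>2 / 4) * 2 ^ card V"
proof -
  have "{\<tau> \<in> W. \<exists>i\<in>V. \<bar>m \<tau> i\<bar> > \<eta>} = (\<Union>i\<in>V. {\<tau> \<in> W. \<bar>m \<tau> i\<bar> > \<eta>})"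
    by auto
  then have "card {\<tau> \<in> W. \<exists>i\<in>V. \<bar>m \<tau> i\<bar> > \<eta>} \<le> (\<Sum>i\<in>V. card {\<tau> \<in> W. \<bar>m \<tau> i\<bar> > \<eta>})"
    by (simp only: card_UN_le[OF finite_V])
  then have "real (card {\<tau> \<in> W. \<exists>i\<in>V. \<bar>m \<tau> i\<bar> > \<eta>}) \<le> (\<Sum>i\<in>V. real (card {\<tau> \<in> W. \<bar>m \<tau> i\<bar> > \<eta>}))"
    unfolding of_nat_sum[symmetric] by (rule of_nat_mono)
  also have "\<dots> \<le> (\<Sum>i\<in>V. 2 * exp (- real d * \<eta>\<^sup>2 / 4) * 2 ^ card V)"
    by (intro sum_mono card_field_gt \<eta>)
  finally show ?thesis by simp
qed

section \<open>Slope of the pseudolikelihood score and position of its zero\<close>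

lemma pl_score_eq_score: "n * pl_score G d \<tau> \<beta> = score \<tau>"
  using card_V_pos by (simp add: pl_score_def score_def)

lemma pl_score_growth:
  assumes "0 \<le> x" "x \<le> y" and B: "\<And>i. i \<in> V \<Longrightarrow> \<bar>y * m \<tau> i\<bar> \<le> B"
  shows "(y - x) * (1 - (tanh B)\<^sup>2) * field_energy \<tau> \<le> n * pl_score G d \<tau> x - n * pl_score G d \<tau> y"
proof -
  have "(y - x) * (1 - (tanh B)\<^sup>2) * field_energy \<tau> = (\<Sum>i\<in>V. (y - x) * (m \<tau> i)\<^sup>2 * (1 - (tanh B)\<^sup>2))"
    by (simp add: field_energy_def sum_distrib_left mult_ac)
  also have "\<dots> \<le> (\<Sum>i\<in>V. m \<tau> i * (tanh (y * m \<tau> i) - tanh (x * m \<tau> i)))"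
    using assms by (intro sum_mono tanh_growth)
  also have "\<dots> = n * pl_score G d \<tau> x - n * pl_score G d \<tau> y"
    using card_V_pos by (simp add: pl_score_def sum_subtractf right_diff_distrib)
  finally show ?thesis .
qed

lemma pl_score_antimono:
  assumes "\<tau> \<in> W" "0 \<le> x" "x \<le> y"
  shows "pl_score G d \<tau> y \<le> pl_score G d \<tau> x"
proof -
  have "\<bar>y * m \<tau> i\<bar> \<le> y" if "i \<in> V" for i
    using abs_field_le_1[OF assms(1) that] assms by (simp add: abs_mult mult_left_le)
  then have "(y - x) * (1 - (tanh y)\<^sup>2) * field_energy \<tau> \<le> n * (pl_score G d \<tau> x - pl_score G d \<tau> y)"
    using pl_score_growth[OF assms(2,3), of \<tau> y] by (simp add: right_diff_distrib)
  moreover have "0 \<le> (y - x) * (1 - (tanh y)\<^sup>2) * field_energy \<tau>"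
    using assms tanh_sq_less_1[of y] by (intro mult_nonneg_nonneg) (auto simp: field_energy_def sum_nonneg)
  ultimately show ?thesis
    using card_V_pos by (smt (verit) zero_le_mult_iff)
qed

text \<open>If the score at 0 is negative, the estimator is 0 by convention; otherwise the
  intermediate value theorem places a zero in \<open>[0, y]\<close>.\<close>

lemma mple_le:
  assumes "0 \<le> y" "pl_score G d \<tau> y < 0"
  shows "mple G d \<tau> \<le> ereal y"
proof (cases "pl_score G d \<tau> 0 < 0")
  case False
  have "continuous_on {0..y} (pl_score G d \<tau>)"
    unfolding pl_score_def
    by (intro continuous_intros) (simp add: cosh_real_pos less_imp_neq[symmetric])
  then obtain z where z: "0 \<le> z" "z \<le> y" "pl_score G d \<tau> z = 0"
    using IVT2'[of "pl_score G d \<tau>" y 0 0] assms False by auto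
  then have "Inf (ereal ` {x. x \<ge> 0 \<and> pl_score G d \<tau> x = 0}) \<le> ereal z"
    by (intro Inf_lower) auto
  also have "\<dots> \<le> ereal y" using z by simp
  finally show ?thesis using False assms by (auto simp: mple_def not_less)
qed (use assms in \<open>auto simp: mple_def zero_ereal_def\<close>)

text \<open>Monotonicity keeps the score positive on all of \<open>[0, x]\<close>, so the convention
  for a negative score at 0 does not apply and every zero lies beyond \<open>x\<close>. The value
  \<infinity> satisfies the claim as well.\<close>

lemma mple_ge:
  assumes "\<tau> \<in> W" "0 \<le> x" "pl_score G d \<tau> x > 0"
  shows "ereal x \<le> mple G d \<tau>"
proof -
  have pos: "pl_score G d \<tau> z > 0" if "0 \<le> z" "z \<le> x" for z
    using pl_score_antimono[OF assms(1) that] assms(3) by linarith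
  have "ereal x \<le> Inf (ereal ` {x. x \<ge> 0 \<and> pl_score G d \<tau> x = 0})"
  proof (intro Inf_greatest)
    fix w assume "w \<in> ereal ` {x. x \<ge> 0 \<and> pl_score G d \<tau> x = 0}"
    then obtain z where "w = ereal z" "z \<ge> 0" "pl_score G d \<tau> z = 0" by auto
    then show "ereal x \<le> w" using pos[of z] by (cases "z \<le> x") auto
  qed
  then show ?thesis using pos[of 0] assms(2) by (auto simp: mple_def)
qed

lemma mple_nonneg: "0 \<le> mple G d \<tau>"
  by (auto simp: mple_def intro!: Inf_greatest)

text \<open>Over a distance \<open>D\<close> from \<beta> the score changes by more than its size at
  \<beta>, so it is negative at \<open>\<beta> + D\<close> and, when \<open>D \<le> \<beta>\<close>,
  positive at \<open>\<beta> - D\<close>. When \<open>D > \<beta>\<close>, the lower end is negative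
  and the estimator is at least 0.\<close>

lemma mple_close:
  assumes \<tau>: "\<tau> \<in> W" and D: "0 < D"
    and B: "\<And>i. i \<in> V \<Longrightarrow> \<bar>m \<tau> i\<bar> * (\<beta> + D) \<le> B"
    and small: "\<bar>score \<tau>\<bar> < D * (1 - (tanh B)\<^sup>2) * field_energy \<tau>"
  shows "\<bar>mple G d \<tau> - ereal \<beta>\<bar> \<le> ereal D"
proof -
  have BD: "\<bar>(\<beta> + D) * m \<tau> i\<bar> \<le> B" if "i \<in> V" for i
    using B[OF that] \<beta>_nonneg D by (simp add: abs_mult mult.commute)
  have "n * pl_score G d \<tau> (\<beta> + D) \<le> score \<tau> - D * (1 - (tanh B)\<^sup>2) * field_energy \<tau>"
    using pl_score_growth[of \<beta> "\<beta> + D" \<tau> B, OF \<beta>_nonneg _ BD] D by (simp add: pl_score_eq_score)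
  then have "n * pl_score G d \<tau> (\<beta> + D) < 0" using small by linarith
  then have "pl_score G d \<tau> (\<beta> + D) < 0"
    using card_V_pos by (simp add: mult_less_0_iff)
  then have up: "mple G d \<tau> \<le> ereal (\<beta> + D)"
    using \<beta>_nonneg D by (intro mple_le) auto
  have low: "ereal (\<beta> - D) \<le> mple G d \<tau>"
  proof (cases "D \<le> \<beta>")
    case True
    have "\<bar>\<beta> * m \<tau> i\<bar> \<le> B" if "i \<in> V" for i
    proof -
      have "\<bar>\<beta> * m \<tau> i\<bar> \<le> \<bar>(\<beta> + D) * m \<tau> i\<bar>"
        using \<beta>_nonneg D by (simp add: abs_mult mult_right_mono)
      then show ?thesis using BD[OF that] by linarith
    qed
    then have "score \<tau> + D * (1 - (tanh B)\<^sup>2) * field_energy \<tau> \<le> n * pl_score G d \<tau> (\<beta> - D)"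
      using pl_score_growth[of "\<beta> - D" \<beta> \<tau> B] True D by (simp add: pl_score_eq_score)
    then have "0 < n * pl_score G d \<tau> (\<beta> - D)" using small by linarith
    then have "0 < pl_score G d \<tau> (\<beta> - D)"
      using card_V_pos by (simp add: zero_less_mult_iff)
    then show ?thesis using True by (intro mple_ge[OF \<tau>]) auto
  next
    case False
    then have "ereal (\<beta> - D) \<le> 0" by (simp add: zero_ereal_def)
    then show ?thesis using mple_nonneg order_trans by blast
  qed
  show ?thesis
    using up low by (cases "mple G d \<tau>") auto
qed

end

section \<open>Consistency\<close>

context regular_ising
begin

lemma mult_tanh_le: "m \<tau> i * tanh (\<beta> * m \<tau> i) \<le> \<beta> * (m \<tau> i)\<^sup>2" "0 \<le> m \<tau> i * tanh (\<beta> * m \<tau> i)"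
proof -
  have "m \<tau> i * tanh (\<beta> * m \<tau> i) \<le> \<bar>m \<tau> i\<bar> * \<bar>tanh (\<beta> * m \<tau> i)\<bar>"
    by (metis abs_ge_self abs_mult)
  also have "\<dots> \<le> \<bar>m \<tau> i\<bar> * \<bar>\<beta> * m \<tau> i\<bar>"
    by (intro mult_left_mono abs_tanh_real_le) auto
  also have "\<dots> = \<beta> * (m \<tau> i)\<^sup>2"
    using \<beta>_nonneg by (simp add: abs_mult power2_eq_square)
  finally show "m \<tau> i * tanh (\<beta> * m \<tau> i) \<le> \<beta> * (m \<tau> i)\<^sup>2" .
  show "0 \<le> m \<tau> i * tanh (\<beta> * m \<tau> i)"
    using \<beta>_nonneg by (cases "m \<tau> i \<ge> 0") (auto simp: zero_le_mult_iff mult_nonneg_nonpos)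
qed

lemma suff_stat_minus_score:
  "0 \<le> H \<tau> - score \<tau>" "H \<tau> - score \<tau> \<le> \<beta> * field_energy \<tau>"
proof -
  have eq: "H \<tau> - score \<tau> = (\<Sum>i\<in>V. m \<tau> i * tanh (\<beta> * m \<tau> i))"
    by (simp add: score_eq)
  show "0 \<le> H \<tau> - score \<tau>"
    unfolding eq by (intro sum_nonneg mult_tanh_le)
  show "H \<tau> - score \<tau> \<le> \<beta> * field_energy \<tau>"
    unfolding eq field_energy_def sum_distrib_left by (intro sum_mono mult_tanh_le)
qed

lemma score_chebyshev:
  assumes "0 < s"
  shows "mean (indicator {\<tau>. s \<le> \<bar>score \<tau>\<bar>}) \<le> mean (\<lambda>\<tau>. (score \<tau>)\<^sup>2) / s\<^sup>2"
proof -
  have "mean (indicator {\<tau>. s \<le> \<bar>score \<tau>\<bar>}) \<le> mean (\<lambda>\<tau>. 1 / s\<^sup>2 * (score \<tau>)\<^sup>2)"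
  proof (rule mean_mono)
    fix \<tau>
    have "s\<^sup>2 \<le> (score \<tau>)\<^sup>2" if "s \<le> \<bar>score \<tau>\<bar>"
      using that assms abs_le_square_iff[of s "score \<tau>"] by simp
    then show "indicator {\<tau>. s \<le> \<bar>score \<tau>\<bar>} \<tau> \<le> 1 / s\<^sup>2 * (score \<tau>)\<^sup>2"
      using assms by (auto simp: indicator_def)
  qed
  then show ?thesis by (simp only: mean_cmult) simp
qed

text \<open>Since \<open>H\<close> is at most the absolute score plus \<beta> times the field
  energy, a small field energy forces a small \<open>H\<close> or a large score. The lower bound on
  \<open>F\<close> makes the first exponentially unlikely, and Chebyshev's inequality handles the
  second.\<close>

lemma prob_field_energy_small:
  assumes \<beta>: "0 < \<beta>" and c: "0 < c" and a: "0 < a"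
    and F: "F \<ge> c * a" and S: "mean (\<lambda>\<tau>. (score \<tau>)\<^sup>2) \<le> C * a"
  shows "mean (indicator {\<tau>. field_energy \<tau> < c / (2 * \<beta>\<^sup>2) * a}) \<le> exp (- (c / 2) * a) + 4 * C * \<beta>\<^sup>2 / c\<^sup>2 / a"
proof -
  \<comment> \<open>With this choice \<open>\<beta> * (\<delta> * a) / 2\<close> is half of the
    lower bound \<open>c * a\<close> for \<open>F\<close>.\<close>
  define \<delta> where "\<delta> = c / \<beta>"
  have \<delta>: "0 < \<delta>" using \<beta> c by (simp add: \<delta>_def)
  have "mean (indicator {\<tau>. field_energy \<tau> < c / (2 * \<beta>\<^sup>2) * a})
      \<le> mean (\<lambda>\<tau>. indicator {\<tau>. H \<tau> < \<delta> * a} \<tau> + indicator {\<tau>. \<delta> * a / 2 \<le> \<bar>score \<tau>\<bar>} \<tau>)"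
  proof (rule mean_mono)
    fix \<tau>
    have "H \<tau> < \<delta> * a" if "field_energy \<tau> < c / (2 * \<beta>\<^sup>2) * a" "\<bar>score \<tau>\<bar> < \<delta> * a / 2"
    proof -
      have "H \<tau> \<le> \<bar>score \<tau>\<bar> + \<beta> * field_energy \<tau>"
        using suff_stat_minus_score(2)[of \<tau>] by linarith
      also have "\<dots> < \<delta> * a / 2 + \<beta> * (c / (2 * \<beta>\<^sup>2) * a)"
        using that \<beta> by (intro add_strict_mono mult_strict_left_mono)
      also have "\<dots> = \<delta> * a"
        using \<beta> by (simp add: \<delta>_def power2_eq_square)
      finally show ?thesis .
    qed
    then show "indicator {\<tau>. field_energy \<tau> < c / (2 * \<beta>\<^sup>2) * a} \<tau>
        \<le> indicator {\<tau>. H \<tau> < \<delta> * a} \<tau> + (indicator {\<tau>. \<delta> * a / 2 \<le> \<bar>score \<tau>\<bar>} \<tau> :: real)"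
      by (auto simp: indicator_def not_le)
  qed
  also have "\<dots> = mean (indicator {\<tau>. H \<tau> < \<delta> * a}) + mean (indicator {\<tau>. \<delta> * a / 2 \<le> \<bar>score \<tau>\<bar>})"
    by (rule mean_add)
  also have "mean (indicator {\<tau>. H \<tau> < \<delta> * a}) \<le> exp (\<beta> * (\<delta> * a) / 2 - F)"
    by (rule prob_suff_stat_less)
  also have "\<dots> \<le> exp (- (c / 2) * a)"
    using F \<beta> by (simp add: \<delta>_def field_simps)
  also have "mean (indicator {\<tau>. \<delta> * a / 2 \<le> \<bar>score \<tau>\<bar>}) \<le> mean (\<lambda>\<tau>. (score \<tau>)\<^sup>2) / (\<delta> * a / 2)\<^sup>2"
    using \<delta> a by (intro score_chebyshev) simp
  also have "\<dots> \<le> C * a / (\<delta> * a / 2)\<^sup>2"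
    by (intro divide_right_mono S) simp
  also have "\<dots> = 4 * C * \<beta>\<^sup>2 / c\<^sup>2 / a"
    using a c \<beta> by (simp add: \<delta>_def power2_eq_square field_simps)
  finally show ?thesis by simp
qed

text \<open>\<open>H\<close> exceeds the score by at most \<beta> times the field energy, and the
  absolute score is at most 1 plus its square; the 1 is absorbed by
  \<open>n / d \<ge> 1\<close>.\<close>

lemma mean_abs_suff_stat_le:
  assumes "\<beta> < 1" and S: "mean (\<lambda>\<tau>. (score \<tau>)\<^sup>2) \<le> C * (n / d)"
  shows "mean (\<lambda>\<tau>. \<bar>H \<tau>\<bar>) \<le> (1 + C + \<beta> / (1 - \<beta>)) * (n / d)"
proof -
  have "mean (\<lambda>\<tau>. \<bar>H \<tau>\<bar>) \<le> mean (\<lambda>\<tau>. 1 + (score \<tau>)\<^sup>2 + \<beta> * field_energy \<tau>)"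
  proof (rule mean_mono)
    fix \<tau>
    have "2 * \<bar>score \<tau>\<bar> \<le> 1 + (score \<tau>)\<^sup>2"
      using sum_squares_bound[of 1 "\<bar>score \<tau>\<bar>"] by simp
    then have "\<bar>score \<tau>\<bar> \<le> 1 + (score \<tau>)\<^sup>2" by linarith
    then show "\<bar>H \<tau>\<bar> \<le> 1 + (score \<tau>)\<^sup>2 + \<beta> * field_energy \<tau>"
      using suff_stat_minus_score[of \<tau>] by linarith
  qed
  also have "\<dots> = 1 + mean (\<lambda>\<tau>. (score \<tau>)\<^sup>2) + \<beta> * mean field_energy"
    by (simp only: mean_add mean_cmult mean_const)
  also have "\<dots> \<le> n / d + C * (n / d) + \<beta> * ((n / d) / (1 - \<beta>))"
    using size_ratio_ge_1 \<beta>_nonneg by (intro add_mono mult_left_mono S mean_field_energy_le assms)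
  also have "\<dots> = (1 + C + \<beta> / (1 - \<beta>)) * (n / d)"
  proof -
    have "x + C * x + \<beta> * (x / (1 - \<beta>)) = (1 + C + \<beta> / (1 - \<beta>)) * x" for x
      by (simp add: distrib_right)
    then show ?thesis .
  qed
  finally show ?thesis .
qed

text \<open>
  As long as \<open>n / d\<close> stays bounded, the Ising measure is contiguous to the uniform measure,
  because the tilting exponent \<open>H\<close> is bounded in mean.
\<close>
lemma prob_le_uniform_high_temperature:
  assumes "\<beta> < 1" and S: "mean (\<lambda>\<tau>. (score \<tau>)\<^sup>2) \<le> C * (n / d)" and "0 \<le> C" "0 < \<epsilon>" "0 < M" and M: "n / d \<le> M"
    and C': "C' = (1 + C + \<beta> / (1 - \<beta>)) * M"
  shows "mean (indicator A) \<le> \<epsilon> + exp (\<beta> * (C' / \<epsilon>) / 2) * (real (card (A \<inter> W)) / 2 ^ card V)"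
proof -
  have C1: "0 < 1 + C + \<beta> / (1 - \<beta>)"
    using assms \<beta>_nonneg by (intro add_pos_nonneg) auto
  then have "0 < C'" unfolding C' using \<open>0 < M\<close> by simp
  have "mean (\<lambda>\<tau>. \<bar>H \<tau>\<bar>) \<le> (1 + C + \<beta> / (1 - \<beta>)) * (n / d)"
    by (intro mean_abs_suff_stat_le assms)
  also have "\<dots> \<le> C'"
    unfolding C' using M C1 by (intro mult_left_mono) auto
  finally have "mean (\<lambda>\<tau>. \<bar>H \<tau>\<bar>) / (C' / \<epsilon>) \<le> C' / (C' / \<epsilon>)"
    using \<open>0 < C'\<close> \<open>0 < \<epsilon>\<close> by (intro divide_right_mono) auto
  also have "\<dots> = \<epsilon>" using \<open>0 < C'\<close> \<open>0 < \<epsilon>\<close> by simp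
  finally show ?thesis
    using prob_le_uniform[of "C' / \<epsilon>" A] \<open>0 < C'\<close> \<open>0 < \<epsilon>\<close> by simp
qed

text \<open>By \<open>field_energy_ge_sum\<close> a small field energy forces a small total spin, to
  which anticoncentration applies with radius \<open>sqrt (n * s)\<close>.\<close>

lemma card_field_energy_less:
  assumes "0 \<le> s"
  shows "real (card ({\<tau>. field_energy \<tau> < s} \<inter> W)) / 2 ^ card V \<le> sqrt s + 1 / sqrt n"
proof -
  have "{\<tau>. field_energy \<tau> < s} \<inter> W \<subseteq> {\<tau> \<in> W. \<bar>\<Sum>i\<in>V. \<tau> i\<bar> < sqrt (n * s)}"
  proof safe
    fix \<tau> assume "field_energy \<tau> < s"
    then have "(\<Sum>i\<in>V. \<tau> i)\<^sup>2 < n * s"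
      using field_energy_ge_sum[of \<tau>] card_V_pos mult_strict_left_mono[of "field_energy \<tau>" s n] by linarith
    then show "\<bar>\<Sum>i\<in>V. \<tau> i\<bar> < sqrt (n * s)"
      by (metis real_sqrt_abs real_sqrt_less_mono)
  qed
  then have "real (card ({\<tau>. field_energy \<tau> < s} \<inter> W)) \<le> real (card {\<tau> \<in> W. \<bar>\<Sum>i\<in>V. \<tau> i\<bar> < sqrt (n * s)})"
    by (intro of_nat_mono card_mono) auto
  also have "\<dots> \<le> (sqrt (n * s) + 1) / sqrt n * 2 ^ card V"
    using assms by (intro card_spins_small_sum finite_V nonempty) simp
  also have "(sqrt (n * s) + 1) / sqrt n = sqrt s + 1 / sqrt n"
    by (simp only: real_sqrt_mult add_divide_distrib) (simp add: nonempty)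
  finally show ?thesis by (simp add: pos_divide_le_eq)
qed

text \<open>\<open>mple_close\<close> is applied with \<open>D = K / sqrt a\<close> and
  \<open>B = \<beta> + 1\<close>. It fails only if the field energy is low, some field is large, or
  the score is large; Chebyshev's inequality handles the last event.\<close>

lemma prob_mple_far:
  assumes K: "0 < K" and a: "0 < a" and c: "0 < c"
    and S: "mean (\<lambda>\<tau>. (score \<tau>)\<^sup>2) \<le> C * a"
  shows "measure_pmf.prob (ising G d \<beta>) {\<sigma>. ereal (sqrt a) * \<bar>mple G d \<sigma> - ereal \<beta>\<bar> > ereal K}
    \<le> mean (indicator {\<tau>. field_energy \<tau> < c * a})
      + mean (indicator {\<tau>. \<exists>i\<in>V. \<bar>m \<tau> i\<bar> * (\<beta> + K / sqrt a) > \<beta> + 1})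
      + C / (K * ((1 - (tanh (\<beta> + 1))\<^sup>2) * c))\<^sup>2"
proof -
  define \<kappa> where "\<kappa> = 1 - (tanh (\<beta> + 1))\<^sup>2"
  have \<kappa>: "0 < \<kappa>" using tanh_sq_less_1[of "\<beta> + 1"] by (simp add: \<kappa>_def)
  \<comment> \<open>This is \<open>D * \<kappa> * (c * a)\<close> with
    \<open>D = K / sqrt a\<close>, the least change of the score when the energy is at least
    \<open>c * a\<close>; \<open>a\<close> then cancels in Chebyshev's bound.\<close>
  define s where "s = K * (\<kappa> * c) * sqrt a"
  have s: "0 < s" using K a c \<kappa> by (simp add: s_def)
  let ?far = "{\<sigma>. ereal (sqrt a) * \<bar>mple G d \<sigma> - ereal \<beta>\<bar> > ereal K}"
  let ?low = "{\<tau>. field_energy \<tau> < c * a}"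
  let ?max = "{\<tau>. \<exists>i\<in>V. \<bar>m \<tau> i\<bar> * (\<beta> + K / sqrt a) > \<beta> + 1}"
  let ?big = "{\<tau>. s \<le> \<bar>score \<tau>\<bar>}"
  have "mean (indicator ?far) \<le> mean (\<lambda>\<tau>. indicator ?low \<tau> + indicator ?max \<tau> + indicator ?big \<tau>)"
  proof (rule mean_mono)
    fix \<tau> assume \<tau>: "\<tau> \<in> W"
    have "\<tau> \<notin> ?far" if "\<tau> \<notin> ?low" "\<tau> \<notin> ?max" "\<tau> \<notin> ?big"
    proof -
      have "s = K / sqrt a * \<kappa> * (c * a)"
        using a by (simp add: s_def field_simps flip: real_sqrt_mult)
      also have "\<dots> \<le> K / sqrt a * \<kappa> * field_energy \<tau>"
        using that(1) K a \<kappa> by (intro mult_left_mono) auto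
      finally have "\<bar>score \<tau>\<bar> < K / sqrt a * (1 - (tanh (\<beta> + 1))\<^sup>2) * field_energy \<tau>"
        using that(3) by (simp add: \<kappa>_def)
      then have "\<bar>mple G d \<tau> - ereal \<beta>\<bar> \<le> ereal (K / sqrt a)"
        using that(2) K a by (intro mple_close[OF \<tau>]) (auto simp: not_less)
      then have "ereal (sqrt a) * \<bar>mple G d \<tau> - ereal \<beta>\<bar> \<le> ereal (sqrt a) * ereal (K / sqrt a)"
        using a by (intro ereal_mult_left_mono) auto
      also have "\<dots> = ereal K" using a by simp
      finally show ?thesis by (simp add: not_less)
    qed
    then show "indicator ?far \<tau> \<le> indicator ?low \<tau> + indicator ?max \<tau> + (indicator ?big \<tau> :: real)"
      unfolding indicator_def of_bool_def by (smt (verit))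
  qed
  also have "\<dots> = mean (indicator ?low) + mean (indicator ?max) + mean (indicator ?big)"
    by (simp only: mean_add)
  also have "mean (indicator ?big) \<le> mean (\<lambda>\<tau>. (score \<tau>)\<^sup>2) / s\<^sup>2"
    by (rule score_chebyshev[OF s])
  also have "\<dots> \<le> C * a / s\<^sup>2"
    by (intro divide_right_mono S) simp
  also have "\<dots> = C / (K * (\<kappa> * c))\<^sup>2"
    using a by (simp add: s_def power_mult_distrib)
  finally show ?thesis by (simp add: prob_eq \<kappa>_def)
qed

text \<open>For \<open>K \<le> sqrt a\<close> the interval around \<beta> has half-width at most 1,
  and no field exceeds 1 in absolute value, so the event contains no configuration.\<close>

lemma prob_max_field_eq_0:
  assumes "0 < K" "K\<^sup>2 \<le> a"
  shows "mean (indicator {\<tau>. \<exists>i\<in>V. \<bar>m \<tau> i\<bar> * (\<beta> + K / sqrt a) > \<beta> + 1}) = 0"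
proof -
  have "K \<le> sqrt a" using assms by (simp add: real_le_rsqrt)
  moreover from this have "0 < sqrt a" using assms(1) by linarith
  ultimately have Ka: "K / sqrt a \<le> 1" "0 \<le> K / sqrt a"
    using assms(1) by (simp_all add: divide_le_eq_1_pos)
  have "mean (indicator {\<tau>. \<exists>i\<in>V. \<bar>m \<tau> i\<bar> * (\<beta> + K / sqrt a) > \<beta> + 1}) = mean (\<lambda>_. 0)"
  proof (rule mean_cong)
    fix \<tau> assume \<tau>: "\<tau> \<in> W"
    have "\<bar>m \<tau> i\<bar> * (\<beta> + K / sqrt a) \<le> 1 * (\<beta> + 1)" if "i \<in> V" for i
      using Ka abs_field_le_1[OF \<tau> that] \<beta>_nonneg by (intro mult_mono) auto
    then show "indicator {\<tau>. \<exists>i\<in>V. \<bar>m \<tau> i\<bar> * (\<beta> + K / sqrt a) > \<beta> + 1} \<tau> = (0 :: real)"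
      by (auto simp: indicator_def not_less)
  qed
  then show ?thesis by (simp add: mean_const)
qed

text \<open>Since \<open>K / sqrt a \<le> K\<close>, the event forces some field above the level
  \<open>(\<beta> + 1) / (\<beta> + K)\<close>, which does not depend on the graph; the Chernoff
  union bound then applies.\<close>

lemma card_scaled_max_field:
  assumes "1 \<le> K" "1 \<le> a"
  shows "real (card ({\<tau>. \<exists>i\<in>V. \<bar>m \<tau> i\<bar> * (\<beta> + K / sqrt a) > \<beta> + 1} \<inter> W)) / 2 ^ card V
    \<le> 2 * n * exp (- real d * ((\<beta> + 1) / (\<beta> + K))\<^sup>2 / 4)"
proof -
  define \<eta> where "\<eta> = (\<beta> + 1) / (\<beta> + K)"
  have pos: "0 < \<beta> + K" using assms \<beta>_nonneg by simp
  have \<eta>: "0 \<le> \<eta>" "\<eta> \<le> 2"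
    using assms \<beta>_nonneg by (auto simp: \<eta>_def divide_le_eq)
  have "K / sqrt a \<le> K"
    using assms by (simp add: divide_le_eq mult_le_cancel_left1)
  have "{\<tau>. \<exists>i\<in>V. \<bar>m \<tau> i\<bar> * (\<beta> + K / sqrt a) > \<beta> + 1} \<inter> W \<subseteq> {\<tau> \<in> W. \<exists>i\<in>V. \<bar>m \<tau> i\<bar> > \<eta>}"
  proof safe
    fix \<tau> i assume i: "i \<in> V" and gt: "\<beta> + 1 < \<bar>m \<tau> i\<bar> * (\<beta> + K / sqrt a)"
    note gt
    also have "\<bar>m \<tau> i\<bar> * (\<beta> + K / sqrt a) \<le> \<bar>m \<tau> i\<bar> * (\<beta> + K)"
      using \<open>K / sqrt a \<le> K\<close> by (intro mult_left_mono) auto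
    finally have "\<eta> < \<bar>m \<tau> i\<bar>"
      using pos by (simp add: \<eta>_def pos_divide_less_eq)
    then show "\<exists>i\<in>V. \<eta> < \<bar>m \<tau> i\<bar>" using i by auto
  qed
  then have "real (card ({\<tau>. \<exists>i\<in>V. \<bar>m \<tau> i\<bar> * (\<beta> + K / sqrt a) > \<beta> + 1} \<inter> W))
      \<le> real (card {\<tau> \<in> W. \<exists>i\<in>V. \<bar>m \<tau> i\<bar> > \<eta>})"
    by (intro of_nat_mono card_mono) auto
  also have "\<dots> \<le> 2 * n * exp (- real d * \<eta>\<^sup>2 / 4) * 2 ^ card V"
    by (rule card_max_field_gt[OF \<eta>])
  finally show ?thesis by (simp add: pos_divide_le_eq \<eta>_def)
qed

end

section \<open>From bounds at each size to consistency\<close>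

lemma rate_consistentI:
  assumes "\<And>\<epsilon>. 0 < \<epsilon> \<Longrightarrow> \<exists>K0. \<forall>K\<ge>K0. eventually (\<lambda>N.
      measure_pmf.prob (P N) {\<sigma>. ereal (b N) * \<bar>est N \<sigma> - ereal \<beta>\<bar> > ereal K} \<le> \<epsilon>) sequentially"
  shows "rate_consistent b P est \<beta>"
proof -
  let ?p = "\<lambda>K N. ereal (measure_pmf.prob (P N) {\<sigma>. ereal (b N) * \<bar>est N \<sigma> - ereal \<beta>\<bar> > ereal K})"
  have "Limsup at_top (\<lambda>K. Limsup sequentially (?p K)) \<le> 0"
  proof (rule ereal_le_epsilon2)
    fix \<epsilon> :: real assume "0 < \<epsilon>"
    then obtain K0 where K0: "\<And>K. K \<ge> K0 \<Longrightarrow> eventually (\<lambda>N. ?p K N \<le> ereal \<epsilon>) sequentially"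
      using assms[of \<epsilon>] by auto
    then have "Limsup sequentially (?p K) \<le> ereal \<epsilon>" if "K \<ge> K0" for K
      using that by (intro Limsup_bounded)
    then have "Limsup at_top (\<lambda>K. Limsup sequentially (?p K)) \<le> ereal \<epsilon>"
      by (intro Limsup_bounded) (auto simp: eventually_at_top_linorder)
    then show "Limsup at_top (\<lambda>K. Limsup sequentially (?p K)) \<le> 0 + ereal \<epsilon>" by simp
  qed
  moreover have "0 \<le> Limsup sequentially (?p K)" for K
    by (rule le_Limsup) auto
  then have "0 \<le> Limsup at_top (\<lambda>K. Limsup sequentially (?p K))"
    by (intro le_Limsup) auto
  ultimately show ?thesis unfolding rate_consistent_def by (rule antisym)
qed

text \<open>The order of choices matters: \<open>c\<close> depends on \<epsilon> alone, then
  \<open>K\<close> is taken large enough for the Chebyshev term, and only then \<open>N\<close>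
  large for this \<open>K\<close>. So \<open>energy\<close> must be uniform in \<open>K\<close>,
  while \<open>field\<close> is asked for each fixed \<open>K\<close>.\<close>

lemma rate_consistent_mple:
  fixes G :: "nat \<Rightarrow> 'v pair_pre_digraph" and a :: "nat \<Rightarrow> real"
  assumes ising: "\<And>N. N \<ge> 2 \<Longrightarrow> regular_ising (G N) (d N) \<beta>"
    and a: "\<And>N. N \<ge> 2 \<Longrightarrow> 1 \<le> a N"
    and score: "\<And>N. N \<ge> 2 \<Longrightarrow>
      regular_ising.mean (G N) (d N) \<beta> (\<lambda>\<tau>. (regular_ising.score (G N) (d N) \<beta> \<tau>)\<^sup>2) \<le> C * a N"
    and energy: "\<And>\<epsilon>. 0 < \<epsilon> \<Longrightarrow> \<exists>c>0. eventually (\<lambda>N. regular_ising.mean (G N) (d N) \<beta>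
        (indicator {\<tau>. regular_ising.field_energy (G N) (d N) \<tau> < c * a N}) \<le> \<epsilon>) sequentially"
    and field: "\<And>K \<epsilon>. 0 < K \<Longrightarrow> 0 < \<epsilon> \<Longrightarrow> eventually (\<lambda>N. regular_ising.mean (G N) (d N) \<beta>
        (indicator {\<tau>. \<exists>i\<in>pverts (G N). \<bar>local_field (G N) (d N) \<tau> i\<bar> * (\<beta> + K / sqrt (a N)) > \<beta> + 1}) \<le> \<epsilon>)
        sequentially"
  shows "rate_consistent (\<lambda>N. sqrt (a N)) (\<lambda>N. ising (G N) (d N) \<beta>) (\<lambda>N. mple (G N) (d N)) \<beta>"
proof (rule rate_consistentI)
  fix \<epsilon> :: real assume \<epsilon>: "0 < \<epsilon>"
  then obtain c where c: "0 < c" and low: "eventually (\<lambda>N. regular_ising.mean (G N) (d N) \<beta>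
        (indicator {\<tau>. regular_ising.field_energy (G N) (d N) \<tau> < c * a N}) \<le> \<epsilon> / 3) sequentially"
    using energy[of "\<epsilon> / 3"] by auto
  define x where "x = (1 - (tanh (\<beta> + 1))\<^sup>2) * c"
  have x: "0 < x" using c tanh_sq_less_1[of "\<beta> + 1"] by (simp add: x_def)
  have "((\<lambda>K. C / (K * x)\<^sup>2) \<longlongrightarrow> 0) at_top"
    using x by real_asymp
  then have "eventually (\<lambda>K. C / (K * x)\<^sup>2 < \<epsilon> / 3) at_top"
    using \<epsilon> by (intro order_tendstoD) auto
  then obtain K1 where K1: "\<And>K. K \<ge> K1 \<Longrightarrow> C / (K * x)\<^sup>2 < \<epsilon> / 3"
    by (auto simp: eventually_at_top_linorder)
  show "\<exists>K0. \<forall>K\<ge>K0. eventually (\<lambda>N. measure_pmf.prob (ising (G N) (d N) \<beta>)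
      {\<sigma>. ereal (sqrt (a N)) * \<bar>mple (G N) (d N) \<sigma> - ereal \<beta>\<bar> > ereal K} \<le> \<epsilon>) sequentially"
  proof (intro exI[of _ "max K1 1"] allI impI)
    fix K assume "max K1 1 \<le> K"
    then have K: "K1 \<le> K" "0 < K" by auto
    have "eventually (\<lambda>N. regular_ising.mean (G N) (d N) \<beta>
        (indicator {\<tau>. \<exists>i\<in>pverts (G N). \<bar>local_field (G N) (d N) \<tau> i\<bar> * (\<beta> + K / sqrt (a N)) > \<beta> + 1}) \<le> \<epsilon> / 3)
        sequentially"
      using field[of K "\<epsilon> / 3"] K \<epsilon> by auto
    then show "eventually (\<lambda>N. measure_pmf.prob (ising (G N) (d N) \<beta>)
      {\<sigma>. ereal (sqrt (a N)) * \<bar>mple (G N) (d N) \<sigma> - ereal \<beta>\<bar> > ereal K} \<le> \<epsilon>) sequentially"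
      using low eventually_ge_at_top[of 2]
    proof eventually_elim
      case (elim N)
      then interpret regular_ising "G N" "d N" \<beta> by (intro ising)
      have "0 < a N" using a[OF elim(3)] by simp
      from prob_mple_far[OF \<open>0 < K\<close> this c score[OF elim(3)]] show ?case
        using elim(1,2) K1[OF K(1)] unfolding x_def by linarith
    qed
  qed
qed

theorem corollary3p1:
  fixes G :: "nat \<Rightarrow> 'v pair_pre_digraph"
    and d :: "nat \<Rightarrow> nat"
    and \<beta>\<^sub>0 :: real
  assumes "\<beta>\<^sub>0 > 0"
    and "\<And>N. N \<ge> 2 \<Longrightarrow> card (pverts (G N)) = N"
    and "\<And>N. N \<ge> 2 \<Longrightarrow> regular_graph (d N) (G N)"
    and "\<And>N. N \<ge> 2 \<Longrightarrow> d N \<ge> 1"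
  shows "(\<beta>\<^sub>0 < 1 \<longrightarrow>
           rate_consistent (\<lambda>N. sqrt (real N / real (d N)))
             (\<lambda>N. ising (G N) (d N) \<beta>\<^sub>0) (\<lambda>N. mple (G N) (d N)) \<beta>\<^sub>0) \<and>
         (\<beta>\<^sub>0 > 1 \<longrightarrow>
           rate_consistent (\<lambda>N. sqrt (real N))
             (\<lambda>N. ising (G N) (d N) \<beta>\<^sub>0) (\<lambda>N. mple (G N) (d N)) \<beta>\<^sub>0)"
proof -
  note \<beta> = assms(1) and card = assms(2)
  have ising: "regular_ising (G N) (d N) \<beta>\<^sub>0" if "N \<ge> 2" for N
    using assms(3,4)[OF that] card[OF that] that \<beta> by unfold_locales auto
  have ratio: "1 \<le> real N / real (d N)" if "N \<ge> 2" for N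
    using regular_ising.size_ratio_ge_1[OF ising[OF that]] card[OF that] by simp
  show ?thesis
  proof (intro conjI impI)
    assume less: "\<beta>\<^sub>0 < 1"
    \<comment> \<open>The constant results from inserting \<open>mean_field_energy_le\<close> into
      \<open>mean_score_sq_le\<close>.\<close>
    define C where "C = (4 + 6 * \<beta>\<^sub>0) * (1 / (1 - \<beta>\<^sub>0)) + 2 * \<beta>\<^sub>0"
    have C: "0 \<le> C" using \<beta> less by (simp add: C_def)
    have S: "regular_ising.mean (G N) (d N) \<beta>\<^sub>0 (\<lambda>\<tau>. (regular_ising.score (G N) (d N) \<beta>\<^sub>0 \<tau>)\<^sup>2)
        \<le> C * (real N / real (d N))" if N: "N \<ge> 2" for N
    proof -
      interpret regular_ising "G N" "d N" \<beta>\<^sub>0 by (rule ising[OF N])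
      have "mean (\<lambda>\<tau>. (score \<tau>)\<^sup>2) \<le> (4 + 6 * \<beta>\<^sub>0) * mean field_energy + 2 * \<beta>\<^sub>0 * (n / d N)"
        by (rule mean_score_sq_le)
      also have "\<dots> \<le> (4 + 6 * \<beta>\<^sub>0) * ((n / d N) / (1 - \<beta>\<^sub>0)) + 2 * \<beta>\<^sub>0 * (n / d N)"
        using \<beta> by (intro add_mono mult_left_mono mean_field_energy_le less) auto
      also have "\<dots> = C * (real N / real (d N))"
      proof -
        have "(4 + 6 * \<beta>\<^sub>0) * (x / (1 - \<beta>\<^sub>0)) + 2 * \<beta>\<^sub>0 * x = C * x" for x
          by (simp add: C_def distrib_right)
        then show ?thesis unfolding card[OF N] .
      qed
      finally show ?thesis .
    qed
    define c1 where "c1 = \<beta>\<^sub>0\<^sup>2 / 32"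
    have c1: "0 < c1" using \<beta> by (simp add: c1_def)
    show "rate_consistent (\<lambda>N. sqrt (real N / real (d N)))
             (\<lambda>N. ising (G N) (d N) \<beta>\<^sub>0) (\<lambda>N. mple (G N) (d N)) \<beta>\<^sub>0"
    proof (rule rate_consistent_mple[OF ising ratio S])
      fix \<epsilon> :: real assume \<epsilon>: "0 < \<epsilon>"
      have "((\<lambda>a. exp (- (c1 / 2) * a) + 4 * C * \<beta>\<^sub>0\<^sup>2 / c1\<^sup>2 / a) \<longlongrightarrow> 0) at_top"
        using c1 by real_asymp
      then have "eventually (\<lambda>a. exp (- (c1 / 2) * a) + 4 * C * \<beta>\<^sub>0\<^sup>2 / c1\<^sup>2 / a < \<epsilon>) at_top"
        using \<epsilon> by (intro order_tendstoD) auto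
      then obtain M0 where M0: "\<And>a. a \<ge> M0 \<Longrightarrow> exp (- (c1 / 2) * a) + 4 * C * \<beta>\<^sub>0\<^sup>2 / c1\<^sup>2 / a < \<epsilon>"
        by (auto simp: eventually_at_top_linorder)
      \<comment> \<open>Ratios \<open>N / d\<close> of at least \<open>M\<close> are covered by
        \<open>prob_field_energy_small\<close>, smaller ones by comparison with fair spins.\<close>
      define M where "M = max M0 1"
      have M: "M0 \<le> M" "0 < M" by (auto simp: M_def)
      define C' where "C' = (1 + C + \<beta>\<^sub>0 / (1 - \<beta>\<^sub>0)) * M"
      define \<Lambda> where "\<Lambda> = exp (\<beta>\<^sub>0 * (C' / (\<epsilon> / 2)) / 2)"
      have \<Lambda>: "0 < \<Lambda>" by (simp add: \<Lambda>_def)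
      \<comment> \<open>Chosen so that \<open>\<Lambda> * sqrt (c * a) \<le> \<epsilon> / 4\<close>
        for \<open>a < M\<close>. The change of measure costs \<epsilon>/2, and the
        anticoncentration error \<open>\<Lambda> / sqrt N\<close> takes the last
        \<epsilon>/4.\<close>
      define c2 where "c2 = (\<epsilon> / (4 * \<Lambda>))\<^sup>2 / M"
      have c2: "0 < c2" using \<epsilon> \<Lambda> M by (simp add: c2_def)
      define c where "c = min (c1 / (2 * \<beta>\<^sub>0\<^sup>2)) c2"
      have "0 < c" using c1 c2 \<beta> by (simp add: c_def)
      moreover have "eventually (\<lambda>N. regular_ising.mean (G N) (d N) \<beta>\<^sub>0
        (indicator {\<tau>. regular_ising.field_energy (G N) (d N) \<tau> < c * (real N / real (d N))}) \<le> \<epsilon>) sequentially"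
      proof -
        have "((\<lambda>N. \<Lambda> * (1 / sqrt (real N))) \<longlongrightarrow> 0) sequentially"
          by real_asymp
        then have "eventually (\<lambda>N. \<Lambda> * (1 / sqrt (real N)) < \<epsilon> / 4) sequentially"
          using \<epsilon> by (intro order_tendstoD) auto
        then show ?thesis
          using eventually_ge_at_top[of 2]
        proof eventually_elim
          case (elim N)
          then interpret regular_ising "G N" "d N" \<beta>\<^sub>0 by (intro ising)
          define a where "a = real N / real (d N)"
          have a: "n / d N = a" "1 \<le> a" using ratio[OF elim(2)] card[OF elim(2)] by (auto simp: a_def)
          have S': "mean (\<lambda>\<tau>. (score \<tau>)\<^sup>2) \<le> C * a"
            using S[OF elim(2)] by (simp add: a_def)
          show ?case
            unfolding a_def[symmetric]
          proof (cases "M \<le> a")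
            case True
            have "mean (indicator {\<tau>. field_energy \<tau> < c * a})
                \<le> mean (indicator {\<tau>. field_energy \<tau> < c1 / (2 * \<beta>\<^sub>0\<^sup>2) * a})"
            proof (rule mean_mono)
              fix \<tau>
              have "c * a \<le> c1 / (2 * \<beta>\<^sub>0\<^sup>2) * a"
                using a by (intro mult_right_mono) (auto simp: c_def)
              then show "indicator {\<tau>. field_energy \<tau> < c * a} \<tau>
                  \<le> (indicator {\<tau>. field_energy \<tau> < c1 / (2 * \<beta>\<^sub>0\<^sup>2) * a} \<tau> :: real)"
                by (auto simp: indicator_def)
            qed
            also have "\<dots> \<le> exp (- (c1 / 2) * a) + 4 * C * \<beta>\<^sub>0\<^sup>2 / c1\<^sup>2 / a"
              using log_partition_ge_high_temperature[OF less] a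
              by (intro prob_field_energy_small \<beta> c1 S') (auto simp: c1_def)
            also have "\<dots> \<le> \<epsilon>" using M0[of a] True M by simp
            finally show "mean (indicator {\<tau>. field_energy \<tau> < c * a}) \<le> \<epsilon>" .
          next
            case False
            have ca: "0 \<le> c * a" "c * a \<le> (\<epsilon> / (4 * \<Lambda>))\<^sup>2"
            proof -
              show "0 \<le> c * a" using \<open>0 < c\<close> a by simp
              have "c * a \<le> c2 * M"
                using False a c2 by (intro mult_mono) (auto simp: c_def)
              then show "c * a \<le> (\<epsilon> / (4 * \<Lambda>))\<^sup>2" using M by (simp add: c2_def)
            qed
            have "sqrt (c * a) \<le> \<epsilon> / (4 * \<Lambda>)"
              using ca \<epsilon> \<Lambda> by (intro real_le_lsqrt) auto
            then have "\<Lambda> * sqrt (c * a) \<le> \<Lambda> * (\<epsilon> / (4 * \<Lambda>))"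
              using \<Lambda> by (intro mult_left_mono) auto
            also have "\<dots> = \<epsilon> / 4" using \<Lambda> by simp
            finally have 1: "\<Lambda> * sqrt (c * a) \<le> \<epsilon> / 4" .
            have "mean (indicator {\<tau>. field_energy \<tau> < c * a})
                \<le> \<epsilon> / 2 + \<Lambda> * (real (card ({\<tau>. field_energy \<tau> < c * a} \<inter> W)) / 2 ^ card V)"
              unfolding \<Lambda>_def
              by (rule prob_le_uniform_high_temperature[OF less _ C _ M(2) _ C'_def])
                (use S' False a \<epsilon> in auto)
            also have "\<dots> \<le> \<epsilon> / 2 + \<Lambda> * (sqrt (c * a) + 1 / sqrt n)"
              using \<Lambda> by (intro add_left_mono mult_left_mono card_field_energy_less ca) auto
            also have "\<dots> \<le> \<epsilon>"
              using 1 elim(1) unfolding card[OF elim(2)] distrib_left by linarith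
            finally show "mean (indicator {\<tau>. field_energy \<tau> < c * a}) \<le> \<epsilon>" .
          qed
        qed
      qed
      ultimately show "\<exists>c>0. eventually (\<lambda>N. regular_ising.mean (G N) (d N) \<beta>\<^sub>0
        (indicator {\<tau>. regular_ising.field_energy (G N) (d N) \<tau> < c * (real N / real (d N))}) \<le> \<epsilon>) sequentially"
        by blast
    next
      fix K \<epsilon> :: real assume K: "0 < K" and \<epsilon>: "0 < \<epsilon>"
      define C' where "C' = (1 + C + \<beta>\<^sub>0 / (1 - \<beta>\<^sub>0)) * K\<^sup>2"
      define \<Lambda> where "\<Lambda> = exp (\<beta>\<^sub>0 * (C' / (\<epsilon> / 2)) / 2)"
      \<comment> \<open>By \<open>prob_max_field_eq_0\<close> only the case
        \<open>a < K\<^sup>2\<close> remains, where \<open>d > N / K\<^sup>2\<close>. The Chernoff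
        exponent is then at least \<open>N * \<gamma>\<close> and beats the factor \<open>N\<close>
        of the union bound.\<close>
      define \<gamma> where "\<gamma> = ((\<beta>\<^sub>0 + 1) / (\<beta>\<^sub>0 + K))\<^sup>2 / 4 / K\<^sup>2"
      have \<Lambda>: "0 < \<Lambda>" by (simp add: \<Lambda>_def)
      have \<gamma>: "0 < \<gamma>" using \<beta> K by (simp add: \<gamma>_def)
      have "((\<lambda>N. \<Lambda> * (2 * real N * exp (- real N * \<gamma>))) \<longlongrightarrow> 0) sequentially"
        using \<gamma> by real_asymp
      then have "eventually (\<lambda>N. \<Lambda> * (2 * real N * exp (- real N * \<gamma>)) < \<epsilon> / 2) sequentially"
        using \<epsilon> by (intro order_tendstoD) auto
      then show "eventually (\<lambda>N. regular_ising.mean (G N) (d N) \<beta>\<^sub>0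
        (indicator {\<tau>. \<exists>i\<in>pverts (G N). \<bar>local_field (G N) (d N) \<tau> i\<bar> * (\<beta>\<^sub>0 + K / sqrt (real N / real (d N))) > \<beta>\<^sub>0 + 1}) \<le> \<epsilon>)
        sequentially"
        using eventually_ge_at_top[of 2]
      proof eventually_elim
        case (elim N)
        then interpret regular_ising "G N" "d N" \<beta>\<^sub>0 by (intro ising)
        define a where "a = real N / real (d N)"
        have a: "n / d N = a" "1 \<le> a" using ratio[OF elim(2)] card[OF elim(2)] by (auto simp: a_def)
        have S': "mean (\<lambda>\<tau>. (score \<tau>)\<^sup>2) \<le> C * a"
          using S[OF elim(2)] by (simp add: a_def)
        let ?A = "{\<tau>. \<exists>i\<in>V. \<bar>m \<tau> i\<bar> * (\<beta>\<^sub>0 + K / sqrt a) > \<beta>\<^sub>0 + 1}"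
        show ?case
          unfolding a_def[symmetric]
        proof (cases "K\<^sup>2 \<le> a")
          case True
          then show "mean (indicator ?A) \<le> \<epsilon>"
            using prob_max_field_eq_0[OF K True] \<epsilon> by simp
        next
          case False
          then have "1 \<le> K\<^sup>2" using a by simp
          then have "1 \<le> K" using K power_mono[of K 1 2] power_less_one_iff[of K 2] by (simp add: not_less[symmetric])
          have "real N * \<gamma> \<le> real (d N) * ((\<beta>\<^sub>0 + 1) / (\<beta>\<^sub>0 + K))\<^sup>2 / 4"
          proof -
            have "real N \<le> real (d N) * K\<^sup>2"
              using False d_pos by (simp add: a_def field_simps)
            then have "real N * (\<gamma> * K\<^sup>2) \<le> real (d N) * K\<^sup>2 * (\<gamma> * K\<^sup>2)"
              using \<gamma> by (intro mult_right_mono) auto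
            then have "real N * \<gamma> * K\<^sup>2 \<le> real (d N) * (\<gamma> * K\<^sup>2) * K\<^sup>2"
              by (simp add: mult_ac)
            then have "real N * \<gamma> \<le> real (d N) * (\<gamma> * K\<^sup>2)"
              using K by (simp add: mult_le_cancel_right)
            then show ?thesis using K by (simp add: \<gamma>_def)
          qed
          then have e: "exp (- real (d N) * ((\<beta>\<^sub>0 + 1) / (\<beta>\<^sub>0 + K))\<^sup>2 / 4) \<le> exp (- real N * \<gamma>)"
            by simp
          have "mean (indicator ?A) \<le> \<epsilon> / 2 + \<Lambda> * (real (card (?A \<inter> W)) / 2 ^ card V)"
            unfolding \<Lambda>_def
            by (rule prob_le_uniform_high_temperature[OF less _ C _ _ _ C'_def])
              (use S' False a \<epsilon> K in auto)
          also have "\<dots> \<le> \<epsilon> / 2 + \<Lambda> * (2 * n * exp (- real (d N) * ((\<beta>\<^sub>0 + 1) / (\<beta>\<^sub>0 + K))\<^sup>2 / 4))"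
            using \<Lambda> \<open>1 \<le> K\<close> a by (intro add_left_mono mult_left_mono card_scaled_max_field) auto
          also have "\<dots> \<le> \<epsilon> / 2 + \<Lambda> * (2 * n * exp (- real N * \<gamma>))"
            using \<Lambda> e by (intro add_left_mono mult_left_mono) auto
          also have "\<dots> \<le> \<epsilon>"
            using elim(1) card[OF elim(2)] by simp
          finally show "mean (indicator ?A) \<le> \<epsilon>" .
        qed
      qed
    qed
  next
    assume greater: "1 < \<beta>\<^sub>0"
    \<comment> \<open>At low temperature the crude bounds by \<open>n\<close>, for the field energy
      and for \<open>n / d\<close>, already give the order \<open>N\<close>.\<close>
    define C where "C = 4 + 8 * \<beta>\<^sub>0"
    have S: "regular_ising.mean (G N) (d N) \<beta>\<^sub>0 (\<lambda>\<tau>. (regular_ising.score (G N) (d N) \<beta>\<^sub>0 \<tau>)\<^sup>2)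
        \<le> C * real N" if N: "N \<ge> 2" for N
    proof -
      interpret regular_ising "G N" "d N" \<beta>\<^sub>0 by (rule ising[OF N])
      have "mean field_energy \<le> n"
        using mean_mono[of field_energy "\<lambda>_. n"] field_energy_le by (simp add: mean_const)
      moreover have "n / d N \<le> n"
        using d_pos by (simp add: divide_le_eq mult_le_cancel_left1)
      moreover have "mean (\<lambda>\<tau>. (score \<tau>)\<^sup>2) \<le> (4 + 6 * \<beta>\<^sub>0) * mean field_energy + 2 * \<beta>\<^sub>0 * (n / d N)"
        by (rule mean_score_sq_le)
      ultimately have "mean (\<lambda>\<tau>. (score \<tau>)\<^sup>2) \<le> (4 + 6 * \<beta>\<^sub>0) * n + 2 * \<beta>\<^sub>0 * n"
        using \<beta> by (smt (verit) mult_left_mono)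
      also have "\<dots> = C * real N"
        by (simp add: C_def card[OF N] algebra_simps)
      finally show ?thesis .
    qed
    obtain t where t: "0 < t" "t < 1" "spin_entropy t < \<beta>\<^sub>0 * t\<^sup>2 / 2"
      using spin_entropy_small[OF greater] by blast
    \<comment> \<open>A lower bound for \<open>F\<close> per spin, positive by the choice of
      \<open>t\<close>; it takes the place of \<open>\<beta>\<^sub>0\<^sup>2 / 32\<close>, now with
      \<open>a = N\<close>.\<close>
    define c1 where "c1 = \<beta>\<^sub>0 * t\<^sup>2 / 2 - spin_entropy t"
    have c1: "0 < c1" using t by (simp add: c1_def)
    show "rate_consistent (\<lambda>N. sqrt (real N))
             (\<lambda>N. ising (G N) (d N) \<beta>\<^sub>0) (\<lambda>N. mple (G N) (d N)) \<beta>\<^sub>0"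
    proof (rule rate_consistent_mple[OF ising _ S])
      fix \<epsilon> :: real assume \<epsilon>: "0 < \<epsilon>"
      have "((\<lambda>N. exp (- (c1 / 2) * real N) + 4 * C * \<beta>\<^sub>0\<^sup>2 / c1\<^sup>2 / real N) \<longlongrightarrow> 0) sequentially"
        using c1 by real_asymp
      then have "eventually (\<lambda>N. exp (- (c1 / 2) * real N) + 4 * C * \<beta>\<^sub>0\<^sup>2 / c1\<^sup>2 / real N < \<epsilon>) sequentially"
        using \<epsilon> by (intro order_tendstoD) auto
      then have "eventually (\<lambda>N. regular_ising.mean (G N) (d N) \<beta>\<^sub>0
        (indicator {\<tau>. regular_ising.field_energy (G N) (d N) \<tau> < c1 / (2 * \<beta>\<^sub>0\<^sup>2) * real N}) \<le> \<epsilon>) sequentially"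
        using eventually_ge_at_top[of 2]
      proof eventually_elim
        case (elim N)
        then interpret regular_ising "G N" "d N" \<beta>\<^sub>0 by (intro ising)
        have "mean (indicator {\<tau>. field_energy \<tau> < c1 / (2 * \<beta>\<^sub>0\<^sup>2) * real N})
            \<le> exp (- (c1 / 2) * real N) + 4 * C * \<beta>\<^sub>0\<^sup>2 / c1\<^sup>2 / real N"
          using log_partition_ge_tilt[OF t(1,2)] elim(2) card[OF elim(2)]
          by (intro prob_field_energy_small \<beta> c1 S) (auto simp: c1_def mult.commute)
        then show ?case using elim(1) by linarith
      qed
      moreover have "0 < c1 / (2 * \<beta>\<^sub>0\<^sup>2)" using c1 \<beta> by simp
      ultimately show "\<exists>c>0. eventually (\<lambda>N. regular_ising.mean (G N) (d N) \<beta>\<^sub>0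
        (indicator {\<tau>. regular_ising.field_energy (G N) (d N) \<tau> < c * real N}) \<le> \<epsilon>) sequentially"
        by blast
    next
      fix K \<epsilon> :: real assume K: "0 < K" and \<epsilon>: "0 < \<epsilon>"
      have "eventually (\<lambda>N. K\<^sup>2 \<le> real N) sequentially"
        by real_asymp
      then show "eventually (\<lambda>N. regular_ising.mean (G N) (d N) \<beta>\<^sub>0
        (indicator {\<tau>. \<exists>i\<in>pverts (G N). \<bar>local_field (G N) (d N) \<tau> i\<bar> * (\<beta>\<^sub>0 + K / sqrt (real N)) > \<beta>\<^sub>0 + 1}) \<le> \<epsilon>)
        sequentially"
        using eventually_ge_at_top[of 2]
      proof eventually_elim
        case (elim N)
        then interpret regular_ising "G N" "d N" \<beta>\<^sub>0 by (intro ising)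
        show ?case using prob_max_field_eq_0[OF K elim(1)] \<epsilon> by simp
      qed
    qed auto
  qed
qed

end
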